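(* Let $\{(y^k,z^k,\lambda^k)\}_{k\ge 1}$ be the sequence generated by the accelerated linearized alternating direction method of multipliers (described in the context) for $\min_{y,z} f(y)+g(z)+h(z)$ subject to $By+Cz=b$, with parameters set, for all $k\ge 1$, to $$\beta_k=\gamma_k=(k+1)\gamma,\qquad P^k=\frac{1}{k+1}P,\qquad Q^k=(k+1)\big(Q-\gamma C^\top C\big)+L_h I,$$ where $\gamma>0$, and $P,Q$ are symmetric matrices with $P\succeq 0$ and $\eta\gamma C^\top C\preceq Q\preceq \frac{\mu_g+\mu_h}{2}I$ with $\eta\ge 1$. Let $$k_0=\left\lceil 1+\frac{2(L_h-\mu_h)}{\mu_g+\mu_h}\right\rceil$$ and $$\phi_k(y,z,\lambda)=\frac{k+k_0}{2k}\|y^k-y\|_P^2+\frac{k+k_0}{2}\left(k\|z^k-z\|_Q^2+(L_h+\mu_g)\|z^k-z\|^2\right)+\frac{k+k_0}{2\gamma k}\|\lambda-\lambda^k\|^2 .$$ Let $(y^*,z^*,\lambda^* )$ be a point satisfying the KKT conditions of the problem. Then, for all $k\ge 1$, $$\|z^k-z^*\|_Q^2\le\frac{2\phi_1(y^*,z^*,\lambda^* )}{k(k+k_0)},\qquad \|z^k-z^*\|^2\le\frac{2\phi_1(y^*,z^*,\lambda^* )}{(k+k_0)(L_h+\mu_h+2\mu_g)},$$ and, for all $t\ge 1$, $$|F(\tilde y^{t+1},\tilde z^{t+1})-F(y^*,z^* )|\le\frac{2}{t(t+2k_0+3)}\phi_1(y^*,z^*,2\lambda^* ),$$ $$\|B\tilde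 y^{t+1}+C\tilde z^{t+1}-b\|\le\frac{2}{t(t+2k_0+3)\|\lambda^*\|}\phi_1(y^*,z^*,2\lambda^* ),$$ where $$\tilde y^{t+1}=\frac{\sum_{k=1}^t(k+k_0+1)y^{k+1}}{\sum_{k=1}^t(k+k_0+1)},\qquad \tilde z^{t+1}=\frac{\sum_{k=1}^t(k+k_0+1)z^{k+1}}{\sum_{k=1}^t(k+k_0+1)}.$$ In addition, if $P\succ 0$ and $\eta>1$, then $\{(y^k,z^k,\lambda^k)\}_{k\ge1}$ is bounded, and $$\|By^{k+1}+Cz^{k+1}-b\|\le o\left(\frac{1}{k+1}\right),\qquad |F(y^{k+1},z^{k+1})-F(y^*,z^* )|\le O\left(\frac{1}{k+1}\right).$$
   Context: Setting: finite-dimensional Euclidean spaces, $B,C$ real matrices and $b$ a vector of compatible sizes, norms Euclidean. $F(y,z)=f(y)+g(z)+h(z)$, where $f$ and $g$ are proper closed convex but possibly nondifferentiable functions (possibly extended-valued), and $h$ is a convex differentiable function with Lipschitz continuous gradient. For a vector $v$ and symmetric matrix $W$, $\|v\|_W^2=v^\top Wv$; $\succeq$ ($\succ$) denotes the positive semidefinite (definite) order on symmetric matrices. KKT conditions for $(y^*,z^*,\lambda^* )$: $0\in\partial F(y^*,z^* )-(B,C)^\top\lambda^*$, i.e. $B^\top\lambda^*\in\partial f(y^* )$ and $C^\top\lambda^*\in\partial g(z^* )+\nabla h(z^* )$, together with $By^*+Cz^*=b$. Assumptions: (1) there exists a point satisfying the KKT conditions; (2) $\nabla h$ is Lipschitz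 continuous with constant $L_h$, and $g$ and $h$ are strongly convex with moduli $\mu_g\ge 0$ and $\mu_h\ge 0$ (modulus $0$ meaning merely convex) satisfying $\mu_g+\mu_h>0$. Accelerated linearized ADMM: choose $(y^1,z^1)$ and set $\lambda^1=0$. For $k=1,2,\ldots$, with parameters $\beta_k,\gamma_k$ and matrices $P^k,Q^k$, perform $$y^{k+1}=\operatorname{argmin}_y\ f(y)-\langle\lambda^k,By\rangle+\frac{\beta_k}{2}\|By+Cz^k-b\|^2+\frac12\|y-y^k\|_{P^k}^2,$$ $$z^{k+1}=\operatorname{argmin}_z\ g(z)+\langle\nabla h(z^k)-C^\top\lambda^k,z\rangle+\frac{\beta_k}{2}\|By^{k+1}+Cz-b\|^2+\frac12\|z-z^k\|_{Q^k}^2,$$ $$\lambda^{k+1}=\lambda^k-\gamma_k(By^{k+1}+Cz^{k+1}-b).$$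
   Formalization: The bound on ‖z^k−z*‖² is proved for k≥2 only: at k=1 it is false (f=g=0, h=z²/2, B=C=0, b=0, P=Q=0, γ=η=1, μ_g=0, μ_h=L_h=1, z¹=1 gives 1≤1/2). The residual bound dividing by ‖λ*‖ is stated for λ*≠0. *)

theory Defs
  imports "HOL-Analysis.Analysis" "HOL-Library.Landau_Symbols"
begin

definition psd :: "real ^ 'n ^ 'n \<Rightarrow> bool" where
  "psd W \<longleftrightarrow> transpose W = W \<and> (\<forall>v. 0 \<le> v \<bullet> (W *v v))"

definition pd :: "real ^ 'n ^ 'n \<Rightarrow> bool" where
  "pd W \<longleftrightarrow> transpose W = W \<and> (\<forall>v. v \<noteq> 0 \<longrightarrow> 0 < v \<bullet> (W *v v))"

definition loewner_le :: "real ^ 'n ^ 'n \<Rightarrow> real ^ 'n ^ 'n \<Rightarrow> bool" where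
  "loewner_le V W \<longleftrightarrow> psd (W - V)"

text \<open>The squared seminorm $\|v\|_W^2 = v^\top W v$.\<close>
definition wnorm2 :: "real ^ 'n ^ 'n \<Rightarrow> real ^ 'n \<Rightarrow> real" where
  "wnorm2 W v = v \<bullet> (W *v v)"

text \<open>Extended-valued convex functions are treated through their epigraph: a function is
  convex, resp. closed (lower semicontinuous), iff its epigraph is.\<close>
definition proper_closed_convex :: "('a::euclidean_space \<Rightarrow> ereal) \<Rightarrow> bool" where
  "proper_closed_convex f \<longleftrightarrow>
     (\<forall>x. f x \<noteq> -\<infinity>) \<and> (\<exists>x. f x \<noteq> \<infinity>) \<and>
     convex {(x, r :: real). f x \<le> ereal r} \<and>
     closed {(x, r :: real). f x \<le> ereal r}"

text \<open>Used for functions that never take the value $-\infty$. Since \<open>0 * \<infinity> = 0\<close> in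
  \<^typ>\<open>ereal\<close>, the condition is void at the end points \<open>t = 0\<close> and \<open>t = 1\<close>.\<close>
definition strongly_convex :: "real \<Rightarrow> ('a::euclidean_space \<Rightarrow> ereal) \<Rightarrow> bool" where
  "strongly_convex \<mu> f \<longleftrightarrow>
     (\<forall>x y t. 0 \<le> t \<and> t \<le> 1 \<longrightarrow>
        f ((1 - t) *\<^sub>R x + t *\<^sub>R y) + ereal (\<mu> / 2 * t * (1 - t) * (norm (x - y))\<^sup>2)
          \<le> ereal (1 - t) * f x + ereal t * f y)"

text \<open>For proper \<open>f\<close> this set is empty at every point where \<open>f\<close> is infinite.\<close>
definition subdiff :: "('a::euclidean_space \<Rightarrow> ereal) \<Rightarrow> 'a \<Rightarrow> 'a set" where
  "subdiff f x = {v. \<forall>u. f x + ereal (v \<bullet> (u - x)) \<le> f u}"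

definition objective ::
  "(real ^ 'm \<Rightarrow> ereal) \<Rightarrow> (real ^ 'n \<Rightarrow> ereal) \<Rightarrow> (real ^ 'n \<Rightarrow> real) \<Rightarrow> real ^ 'm \<Rightarrow> real ^ 'n \<Rightarrow> ereal"
  where "objective f g h y z = f y + g z + ereal (h z)"

text \<open>Here \<open>gh\<close> is the gradient of the smooth part \<open>h\<close>.\<close>
definition KKT_point ::
  "(real ^ 'm \<Rightarrow> ereal) \<Rightarrow> (real ^ 'n \<Rightarrow> ereal) \<Rightarrow> (real ^ 'n \<Rightarrow> real ^ 'n) \<Rightarrow>
   real ^ 'm ^ 'p \<Rightarrow> real ^ 'n ^ 'p \<Rightarrow> real ^ 'p \<Rightarrow>
   real ^ 'm \<Rightarrow> real ^ 'n \<Rightarrow> real ^ 'p \<Rightarrow> bool" where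
  "KKT_point f g gh B C b y z l \<longleftrightarrow>
     transpose B *v l \<in> subdiff f y \<and>
     transpose C *v l \<in> (\<lambda>v. v + gh z) ` subdiff g z \<and>
     B *v y + C *v z = b"

text \<open>The iteration starts at index 1; the values of the sequences at index 0 are irrelevant.
  Since \<open>P k\<close> may be only semidefinite, the minimizer in the \<open>y\<close>-step need not
  be unique, and any minimizer is allowed.\<close>
definition linearized_ADMM ::
  "(real ^ 'm \<Rightarrow> ereal) \<Rightarrow> (real ^ 'n \<Rightarrow> ereal) \<Rightarrow> (real ^ 'n \<Rightarrow> real ^ 'n) \<Rightarrow>
   real ^ 'm ^ 'p \<Rightarrow> real ^ 'n ^ 'p \<Rightarrow> real ^ 'p \<Rightarrow>
   (nat \<Rightarrow> real) \<Rightarrow> (nat \<Rightarrow> real) \<Rightarrow> (nat \<Rightarrow> real ^ 'm ^ 'm) \<Rightarrow> (nat \<Rightarrow> real ^ 'n ^ 'n) \<Rightarrow>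
   (nat \<Rightarrow> real ^ 'm) \<Rightarrow> (nat \<Rightarrow> real ^ 'n) \<Rightarrow> (nat \<Rightarrow> real ^ 'p) \<Rightarrow> bool" where
  "linearized_ADMM f g gh B C b \<beta> \<gamma> P Q y z l \<longleftrightarrow>
     l 1 = 0 \<and>
     (\<forall>k\<ge>1.
        is_arg_min
          (\<lambda>u. f u + ereal (- (l k \<bullet> (B *v u))
                 + \<beta> k / 2 * (norm (B *v u + C *v z k - b))\<^sup>2
                 + 1 / 2 * wnorm2 (P k) (u - y k)))
          (\<lambda>_. True) (y (k + 1)) \<and>
        is_arg_min
          (\<lambda>w. g w + ereal ((gh (z k) - transpose C *v l k) \<bullet> w
                 + \<beta> k / 2 * (norm (B *v y (k + 1) + C *v w - b))\<^sup>2
                 + 1 / 2 * wnorm2 (Q k) (w - z k)))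
          (\<lambda>_. True) (z (k + 1)) \<and>
        l (k + 1) = l k - \<gamma> k *\<^sub>R (B *v y (k + 1) + C *v z (k + 1) - b))"

definition k0_of :: "real \<Rightarrow> real \<Rightarrow> real \<Rightarrow> int" where
  "k0_of Lh \<mu>g \<mu>h = \<lceil>1 + 2 * (Lh - \<mu>h) / (\<mu>g + \<mu>h)\<rceil>"

text \<open>The merit function $\phi_k$; the first three vector arguments are the iterates
  $y^k, z^k, \lambda^k$, the last three the reference point $(y, z, \lambda)$.\<close>
definition merit ::
  "real ^ 'm ^ 'm \<Rightarrow> real ^ 'n ^ 'n \<Rightarrow> real \<Rightarrow> real \<Rightarrow> real \<Rightarrow> int \<Rightarrow> nat \<Rightarrow>
   real ^ 'm \<Rightarrow> real ^ 'n \<Rightarrow> real ^ 'p \<Rightarrow> real ^ 'm \<Rightarrow> real ^ 'n \<Rightarrow> real ^ 'p \<Rightarrow> real" where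
  "merit P Q \<gamma> Lh \<mu>g k0 k yk zk lk y z l =
     (real k + real_of_int k0) / (2 * real k) * wnorm2 P (yk - y)
     + (real k + real_of_int k0) / 2
         * (real k * wnorm2 Q (zk - z) + (Lh + \<mu>g) * (norm (zk - z))\<^sup>2)
     + (real k + real_of_int k0) / (2 * \<gamma> * real k) * (norm (l - lk))\<^sup>2"

text \<open>\<open>ergodic k0 x t\<close> is the weighted average of \<open>x 2, \<dots>, x (t + 1)\<close>, written
  $\tilde x^{t+1}$ in the literature (note the shifted index).\<close>
definition ergodic :: "int \<Rightarrow> (nat \<Rightarrow> 'a::real_vector) \<Rightarrow> nat \<Rightarrow> 'a" where
  "ergodic k0 x t =
     (\<Sum>k = 1..t. (real k + real_of_int k0 + 1) *\<^sub>R x (k + 1))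
       /\<^sub>R (\<Sum>k = 1..t. real k + real_of_int k0 + 1)"

end

theory Submission
  imports Defs
begin

text \<open>
  Adding the subgradient inequalities of the two subproblems, the descent inequality for the
  smooth part and the three-point identities bounds the Lagrangian gap
  \<open>F(y(k+1), z(k+1)) - F(y*, z*) - \<langle>\<lambda>, r(k+1)\<rangle>\<close> (where \<open>r = B y + C z - b\<close>) by a difference of weighted
  squared distances, for every multiplier \<open>\<lambda>\<close>. Multiplied by \<open>k + k\<^sub>0 + 1\<close> the difference telescopes:
  the distance terms in \<open>z\<close> gain enough from strong convexity exactly when
  \<open>2 (L\<^sub>h - \<mu>\<^sub>h) \<le> (k\<^sub>0 - 1) (\<mu>\<^sub>g + \<mu>\<^sub>h)\<close>, because \<open>Q \<preceq> (\<mu>\<^sub>g + \<mu>\<^sub>h) / 2\<close>. At \<open>\<lambda> = \<lambda>*\<close> the gap is nonnegative,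
  so the potential decreases, which gives the rates for \<open>z\<close>; the ergodic rates follow from Jensen's
  inequality and a suitable choice of \<open>\<lambda>\<close>. For \<open>\<eta> > 1\<close>, Young's inequality leaves over a positive
  multiple of \<open>(k + 1) \<parallel>r(k+1)\<parallel>\<^sup>2\<close>, so \<open>(k + 1)\<^sup>2 \<parallel>r(k+1)\<parallel>\<^sup>2\<close> is summable.
\<close>

section \<open>Quadratic forms\<close>

lemma inner_transpose_mult:
  fixes A :: "real ^ 'n ^ 'm"
  shows "(transpose A *v x) \<bullet> w = x \<bullet> (A *v w)"
  by (simp add: dot_lmul_matrix)

lemma wnorm2_add:
  assumes "transpose W = W"
  shows "wnorm2 W (u + v) = wnorm2 W u + 2 * ((W *v u) \<bullet> v) + wnorm2 W v"
proof -
  have "u \<bullet> (W *v v) = (W *v u) \<bullet> v"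
    using inner_transpose_mult[of W u v] assms by simp
  then show ?thesis
    by (simp add: wnorm2_def matrix_vector_right_distrib inner_add_left inner_add_right inner_commute)
qed

lemma wnorm2_scaleR: "wnorm2 W (t *\<^sub>R v) = t\<^sup>2 * wnorm2 W v"
  by (simp add: wnorm2_def matrix_vector_mult_scaleR power2_eq_square)

lemma wnorm2_zero [simp]: "wnorm2 W 0 = 0"
  by (simp add: wnorm2_def)

text \<open>Polarization: \<open>v - w\<close> is the difference of \<open>u - w\<close> and
  \<open>u - v\<close>. This turns proximal inner products into differences of squared distances
  that can telescope.\<close>

lemma wnorm2_three_point:
  assumes "transpose W = W"
  shows "(W *v (u - v)) \<bullet> (u - w) = (wnorm2 W (u - w) + wnorm2 W (u - v) - wnorm2 W (v - w)) / 2"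
proof -
  have "wnorm2 W ((u - v) + - 1 *\<^sub>R (u - w))
        = wnorm2 W (u - v) + 2 * ((W *v (u - v)) \<bullet> (- 1 *\<^sub>R (u - w))) + wnorm2 W (- 1 *\<^sub>R (u - w))"
    using assms by (rule wnorm2_add)
  moreover have "(u - v) + - 1 *\<^sub>R (u - w) = - 1 *\<^sub>R (v - w)"
    by simp
  ultimately show ?thesis
    by (simp only: wnorm2_scaleR inner_scaleR_right) simp
qed

lemma loewner_le_wnorm2: "loewner_le V W \<Longrightarrow> wnorm2 V v \<le> wnorm2 W v"
  by (simp add: loewner_le_def psd_def wnorm2_def matrix_vector_mult_diff_rdistrib inner_diff_right)

lemma wnorm2_gram: "wnorm2 (s *\<^sub>R (transpose A ** A)) v = s * (norm (A *v v))\<^sup>2"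
  by (simp add: wnorm2_def scaleR_matrix_vector_assoc[symmetric] matrix_vector_mul_assoc[symmetric]
      dot_lmul_matrix inner_commute[of v] power2_norm_eq_inner)

lemma wnorm2_scaled_identity: "wnorm2 (s *\<^sub>R mat 1) v = s * (norm v)\<^sup>2"
  by (simp add: wnorm2_def scaleR_matrix_vector_assoc[symmetric] power2_norm_eq_inner)

text \<open>By compactness the form attains its minimum on the unit sphere; the minimum is positive,
  and homogeneity of degree two extends the bound to all vectors.\<close>

lemma pd_coercive:
  fixes W :: "real ^ 'n ^ 'n"
  assumes "pd W"
  obtains c where "c > 0" "\<And>v. c * (norm v)\<^sup>2 \<le> wnorm2 W v"
proof -
  have "continuous_on (sphere 0 1) (wnorm2 W)"
    unfolding wnorm2_def by (intro continuous_intros)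
  moreover have "sphere (0 :: real ^ 'n) 1 \<noteq> {}" by simp
  ultimately obtain e where e: "e \<in> sphere 0 1" "\<And>v. v \<in> sphere 0 1 \<Longrightarrow> wnorm2 W e \<le> wnorm2 W v"
    using continuous_attains_inf[OF compact_sphere] by blast
  show ?thesis
  proof
    have "e \<noteq> 0" using e(1) by auto
    then show "0 < wnorm2 W e" using assms by (simp add: pd_def wnorm2_def)
    show "wnorm2 W e * (norm v)\<^sup>2 \<le> wnorm2 W v" for v
    proof (cases "v = 0")
      case False
      define u where "u = v /\<^sub>R norm v"
      have v: "v = norm v *\<^sub>R u" and "u \<in> sphere 0 1"
        using False by (simp_all add: u_def)
      have "wnorm2 W v = (norm v)\<^sup>2 * wnorm2 W u"
        by (subst v) (rule wnorm2_scaleR)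
      with e(2)[OF \<open>u \<in> sphere 0 1\<close>] show ?thesis
        by (simp add: mult.commute mult_right_mono)
    qed simp
  qed
qed

section \<open>Convexity and subgradients\<close>

text \<open>Passes from the epigraph to pointwise inequalities, so that \<open>f\<close> can be fed
  to the same optimality lemma as \<open>g\<close>, with modulus 0.\<close>

lemma proper_closed_convex_imp_strongly_convex:
  assumes "proper_closed_convex f"
  shows "strongly_convex 0 f"
  unfolding strongly_convex_def
proof (intro allI impI)
  fix x y :: 'a and t :: real
  assume t: "0 \<le> t \<and> t \<le> 1"
  have ninf: "\<And>u. f u \<noteq> -\<infinity>" and cvx: "convex {(u, r :: real). f u \<le> ereal r}"
    using assms by (auto simp: proper_closed_convex_def)
  show "f ((1 - t) *\<^sub>R x + t *\<^sub>R y) + ereal (0 / 2 * t * (1 - t) * (norm (x - y))\<^sup>2)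
        \<le> ereal (1 - t) * f x + ereal t * f y"
  \<comment> \<open>At the end points \<open>0 * \<infinity> = 0\<close>, so an infinite value need
    not make the right side infinite; strictly between them it does.\<close>
  proof (cases "t = 0 \<or> t = 1")
    case True
    then show ?thesis by (elim disjE) (simp_all flip: zero_ereal_def one_ereal_def)
  next
    case False
    with t have t': "0 < t" "0 < 1 - t" by auto
    show ?thesis
    proof (cases "f x = \<infinity> \<or> f y = \<infinity>")
      case True
      then have "ereal (1 - t) * f x + ereal t * f y = \<infinity>"
        using t' ninf[of x] ninf[of y] by (cases "f x"; cases "f y") auto
      then show ?thesis by (simp only: ereal_less_eq)
    next
      case False
      then obtain a b where ab: "f x = ereal a" "f y = ereal b"
        using ninf[of x] ninf[of y] by (cases "f x"; cases "f y") auto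
      have "(1 - t) *\<^sub>R (x, a) + t *\<^sub>R (y, b) \<in> {(u, r :: real). f u \<le> ereal r}"
        using ab t by (intro convexD[OF cvx]) auto
      then show ?thesis using ab by auto
    qed
  qed
qed

text \<open>Convexity of the epigraph is applied to the points \<open>(x i, r i)\<close>, which
  avoids arithmetic with infinite values.\<close>

lemma proper_closed_convex_finite_Jensen:
  fixes x :: "nat \<Rightarrow> 'a::euclidean_space"
  assumes f: "proper_closed_convex f" and I: "finite I"
    and w: "\<And>i. i \<in> I \<Longrightarrow> 0 \<le> w i" "sum w I = 1"
    and fx: "\<And>i. i \<in> I \<Longrightarrow> f (x i) = ereal (r i)"
  shows "f (\<Sum>i\<in>I. w i *\<^sub>R x i) \<le> ereal (\<Sum>i\<in>I. w i * r i)"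
proof -
  have cvx: "convex {(u, r :: real). f u \<le> ereal r}"
    using f by (simp add: proper_closed_convex_def)
  have "(\<Sum>i\<in>I. w i *\<^sub>R (x i, r i)) \<in> {(u, r :: real). f u \<le> ereal r}"
    using w fx by (intro convex_sum[OF I cvx]) auto
  moreover have "(\<Sum>i\<in>I. w i *\<^sub>R (x i, r i)) = (\<Sum>i\<in>I. w i *\<^sub>R x i, \<Sum>i\<in>I. w i * r i)"
    by (simp add: sum_prod)
  ultimately show ?thesis by simp
qed

text \<open>Compare the minimizer with \<open>x + t *\<^sub>R (u - x)\<close>, divide by
  \<open>t\<close> and let \<open>t\<close> tend to 0 from the right. Only the expansion of
  \<open>q\<close> along lines is used; its remainder \<open>R\<close> vanishes in the
  limit.\<close>

lemma strongly_convex_argmin_subgradient: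
  assumes cvx: "strongly_convex \<mu> f"
    and fx: "f x = ereal r"
    and min: "\<And>u. f x + ereal (q x) \<le> f u + ereal (q u)"
    and quad: "\<And>t d. q (x + t *\<^sub>R d) = q x + t * (a \<bullet> d) + t\<^sup>2 * R d"
  shows "f x + ereal (- a \<bullet> (u - x) + \<mu> / 2 * (norm (u - x))\<^sup>2) \<le> f u"
proof (cases "f u")
  case (real s)
  define d where "d = u - x"
  have step: "r - a \<bullet> d + \<mu> / 2 * (1 - t) * (norm d)\<^sup>2 - t * R d \<le> s" if t: "0 < t" "t < 1" for t
  proof -
    have eq: "(1 - t) *\<^sub>R x + t *\<^sub>R u = x + t *\<^sub>R d"
      by (simp add: d_def algebra_simps)
    have "f (x + t *\<^sub>R d) + ereal (\<mu> / 2 * t * (1 - t) * (norm (x - u))\<^sup>2)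
        \<le> ereal (1 - t) * f x + ereal t * f u"
      using cvx t unfolding strongly_convex_def eq[symmetric] by simp
    then have 1: "f (x + t *\<^sub>R d) + ereal (\<mu> / 2 * t * (1 - t) * (norm d)\<^sup>2)
        \<le> ereal ((1 - t) * r + t * s)"
      using fx real by (simp add: d_def norm_minus_commute)
    have 2: "f x + ereal (q x) \<le> f (x + t *\<^sub>R d) + ereal (q (x + t *\<^sub>R d))"
      by (rule min)
    \<comment> \<open>The first inequality excludes the value \<open>\<infinity>\<close> at the
      perturbed point, the second one \<open>-\<infinity>\<close>.\<close>
    obtain p where p: "f (x + t *\<^sub>R d) = ereal p"
      using 1 2 fx by (cases "f (x + t *\<^sub>R d)") auto
    have "p + \<mu> / 2 * t * (1 - t) * (norm d)\<^sup>2 \<le> (1 - t) * r + t * s"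
      using 1 p by simp
    moreover have "r \<le> p + t * (a \<bullet> d) + t\<^sup>2 * R d"
      using 2 p fx quad[of t d] by simp
    ultimately have "t * (r - a \<bullet> d + \<mu> / 2 * (1 - t) * (norm d)\<^sup>2 - t * R d) \<le> t * s"
      by (simp add: algebra_simps power2_eq_square)
    with t show ?thesis by simp
  qed
  have lim: "((\<lambda>t. r - a \<bullet> d + \<mu> / 2 * (1 - t) * (norm d)\<^sup>2 - t * R d)
      \<longlongrightarrow> r - a \<bullet> d + \<mu> / 2 * (1 - 0) * (norm d)\<^sup>2 - 0 * R d) (at_right 0)"
    by (intro tendsto_intros)
  have "eventually (\<lambda>t::real. r - a \<bullet> d + \<mu> / 2 * (1 - t) * (norm d)\<^sup>2 - t * R d \<le> s) (at_right 0)"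
    unfolding eventually_at_right_field by (intro exI[of _ 1]) (use step in auto)
  then have "r - a \<bullet> d + \<mu> / 2 * (1 - 0) * (norm d)\<^sup>2 - 0 * R d \<le> s"
    using tendsto_upperbound[OF lim] by simp
  then show ?thesis using fx real by (simp add: d_def algebra_simps)
next
  case PInf
  then show ?thesis by simp
next
  case MInf
  then have "f x + ereal (q x) \<le> -\<infinity>" using min[of u] by simp
  with fx show ?thesis by simp
qed

text \<open>A subgradient \<open>v\<close> at \<open>x\<close> says that \<open>x\<close> minimizes
  \<open>f\<close> minus the linear form of \<open>v\<close>; the preceding lemma with zero
  second-order term then adds the quadratic gain.\<close>

lemma subdiff_strongly_convex:
  assumes "strongly_convex \<mu> f" "f x = ereal r" "v \<in> subdiff f x"
  shows "f x + ereal (v \<bullet> (u - x) + \<mu> / 2 * (norm (u - x))\<^sup>2) \<le> f u"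
proof -
  have "f x + ereal (- v \<bullet> x) \<le> f u + ereal (- v \<bullet> u)" for u
  proof -
    have "f x + ereal (v \<bullet> (u - x)) \<le> f u"
      using assms(3) by (simp add: subdiff_def)
    then show ?thesis
      using assms(2) by (cases "f u") (auto simp: inner_diff_right)
  qed
  from strongly_convex_argmin_subgradient[OF assms(1,2) this, where a = "- v" and R = "\<lambda>_. 0"]
  show ?thesis by (simp add: inner_add_right)
qed

text \<open>The vector under the minus sign is the gradient at \<open>x\<close> of the quadratic
  part of the subproblem. \<open>f x\<close> is finite because the minimal value is at most the
  value at some point of the domain.\<close>

lemma prox_step_subgradient:
  fixes f :: "real ^ 'n \<Rightarrow> ereal" and A :: "real ^ 'n ^ 'p"
  assumes cvx: "strongly_convex \<mu> f" and f: "proper_closed_convex f"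
    and W: "transpose W = W"
    and min: "is_arg_min (\<lambda>u. f u + ereal (a \<bullet> u + \<beta> / 2 * (norm (A *v u + c))\<^sup>2
                 + 1 / 2 * wnorm2 W (u - x0))) (\<lambda>_. True) x"
  obtains r where "f x = ereal r"
    and "\<And>u. f x + ereal (- (a + transpose A *v (\<beta> *\<^sub>R (A *v x + c)) + W *v (x - x0)) \<bullet> (u - x)
            + \<mu> / 2 * (norm (u - x))\<^sup>2) \<le> f u"
proof -
  define q where "q u = a \<bullet> u + \<beta> / 2 * (norm (A *v u + c))\<^sup>2 + 1 / 2 * wnorm2 W (u - x0)" for u
  have min': "f x + ereal (q x) \<le> f u + ereal (q u)" for u
    using min unfolding is_arg_min_def q_def by (auto simp: not_less)
  obtain u0 where u0: "f u0 \<noteq> \<infinity>" using f by (auto simp: proper_closed_convex_def)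
  have "f u0 \<noteq> -\<infinity>" "f x \<noteq> -\<infinity>" using f by (auto simp: proper_closed_convex_def)
  then obtain r where r: "f x = ereal r"
    using min'[of u0] u0 by (cases "f x"; cases "f u0") auto
  have "q (x + t *\<^sub>R d) = q x
      + t * ((a + transpose A *v (\<beta> *\<^sub>R (A *v x + c)) + W *v (x - x0)) \<bullet> d)
      + t\<^sup>2 * (\<beta> / 2 * (norm (A *v d))\<^sup>2 + 1 / 2 * wnorm2 W d)" for t d
  proof -
    have w: "wnorm2 W (x + t *\<^sub>R d - x0)
        = wnorm2 W (x - x0) + 2 * t * ((W *v (x - x0)) \<bullet> d) + t\<^sup>2 * wnorm2 W d"
      using wnorm2_add[OF W, of "x - x0" "t *\<^sub>R d"]
      by (simp add: wnorm2_scaleR algebra_simps)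
    have n: "(norm (A *v (x + t *\<^sub>R d) + c))\<^sup>2
        = (norm (A *v x + c))\<^sup>2 + 2 * t * ((A *v x + c) \<bullet> (A *v d)) + t\<^sup>2 * (norm (A *v d))\<^sup>2"
      unfolding power2_norm_eq_inner
      by (simp add: matrix_vector_right_distrib matrix_vector_mult_scaleR inner_add_left
          inner_add_right inner_commute algebra_simps power2_eq_square)
    show ?thesis
      unfolding q_def w n by (simp add: inner_add_left inner_add_right dot_lmul_matrix algebra_simps)
  qed
  from strongly_convex_argmin_subgradient[OF cvx r min' this] r that show ?thesis by blast
qed

section \<open>Gradients: quadratic lower and upper bounds\<close>

lemma GDERIV_along_line:
  fixes h :: "'a::euclidean_space \<Rightarrow> real"
  assumes "\<forall>w. GDERIV h w :> gh w"
  shows "((\<lambda>t. h (x + t *\<^sub>R d)) has_real_derivative gh (x + t *\<^sub>R d) \<bullet> d) (at t)"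
proof -
  have h: "(h has_derivative (\<lambda>e. gh w \<bullet> e)) (at w)" for w
    using assms unfolding gderiv_def by (simp add: inner_commute)
  have "((\<lambda>t. x + t *\<^sub>R d) has_derivative (\<lambda>s. s *\<^sub>R d)) (at t)"
    by (auto intro!: derivative_eq_intros)
  from has_derivative_compose[OF this h] show ?thesis
    by (simp add: has_field_derivative_def mult.commute[of _ "gh (x + t *\<^sub>R d) \<bullet> d"])
qed

text \<open>The difference quotient along the segment tends to
  \<open>gh x \<bullet> (u - x)\<close>, while strong convexity bounds it by
  \<open>h u - h x\<close> minus a quadratic term for every \<open>t\<close> strictly between 0 and
  1.\<close>

lemma gradient_strongly_convex:
  fixes h :: "'a::euclidean_space \<Rightarrow> real"
  assumes grad: "\<forall>w. GDERIV h w :> gh w" and cvx: "strongly_convex \<mu> (\<lambda>w. ereal (h w))"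
  shows "h x + gh x \<bullet> (u - x) + \<mu> / 2 * (norm (u - x))\<^sup>2 \<le> h u"
proof -
  define d where "d = u - x"
  have step: "(h (x + t *\<^sub>R d) - h x) / t + \<mu> / 2 * (1 - t) * (norm d)\<^sup>2 \<le> h u - h x"
    if t: "0 < t" "t < 1" for t
  proof -
    have "(1 - t) *\<^sub>R x + t *\<^sub>R u = x + t *\<^sub>R d"
      by (simp add: d_def algebra_simps)
    then have "h (x + t *\<^sub>R d) + \<mu> / 2 * t * (1 - t) * (norm (x - u))\<^sup>2 \<le> (1 - t) * h x + t * h u"
      using cvx t unfolding strongly_convex_def
      by (metis ereal_less_eq(3) less_eq_real_def plus_ereal.simps(1) times_ereal.simps(1))
    then have "h (x + t *\<^sub>R d) - h x + t * (\<mu> / 2 * (1 - t) * (norm d)\<^sup>2) \<le> t * (h u - h x)"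
      by (simp add: d_def norm_minus_commute algebra_simps)
    with t show ?thesis by (simp add: field_simps)
  qed
  have "((\<lambda>t. (h (x + t *\<^sub>R d) - h x) / t) \<longlongrightarrow> gh x \<bullet> d) (at_right 0)"
    using GDERIV_along_line[OF grad, of x d 0]
    by (auto simp: has_field_derivative_iff intro: tendsto_mono[OF at_le])
  then have lim: "((\<lambda>t. (h (x + t *\<^sub>R d) - h x) / t + \<mu> / 2 * (1 - t) * (norm d)\<^sup>2)
      \<longlongrightarrow> gh x \<bullet> d + \<mu> / 2 * (1 - 0) * (norm d)\<^sup>2) (at_right 0)"
    by (intro tendsto_intros)
  have "eventually (\<lambda>t. (h (x + t *\<^sub>R d) - h x) / t + \<mu> / 2 * (1 - t) * (norm d)\<^sup>2 \<le> h u - h x) (at_right 0)"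
    unfolding eventually_at_right_field by (intro exI[of _ 1]) (use step in auto)
  then have "gh x \<bullet> d + \<mu> / 2 * (1 - 0) * (norm d)\<^sup>2 \<le> h u - h x"
    using tendsto_upperbound[OF lim] by simp
  then show ?thesis by (simp add: d_def)
qed

lemma lipschitz_gradient_descent:
  fixes h :: "'a::euclidean_space \<Rightarrow> real"
  assumes grad: "\<forall>w. GDERIV h w :> gh w" and lip: "L-lipschitz_on UNIV gh"
  shows "h u \<le> h x + gh x \<bullet> (u - x) + L / 2 * (norm (u - x))\<^sup>2"
proof -
  define d where "d = u - x"
  \<comment> \<open>\<open>\<phi>\<close> is \<open>h\<close> on the segment minus the linear and
    quadratic terms of the claimed bound. The Lipschitz condition makes its derivative nonpositive
    on the unit interval, and the claim is \<open>\<phi> 1 \<le> \<phi> 0\<close>.\<close>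
  define \<phi> where "\<phi> t = h (x + t *\<^sub>R d) - t * (gh x \<bullet> d) - L / 2 * t\<^sup>2 * (norm d)\<^sup>2" for t
  have "\<phi> 1 \<le> \<phi> 0"
  proof (rule DERIV_nonpos_imp_nonincreasing[of 0 1])
    fix t :: real
    assume t: "0 \<le> t" "t \<le> 1"
    have "(\<phi> has_real_derivative gh (x + t *\<^sub>R d) \<bullet> d - gh x \<bullet> d - L * t * (norm d)\<^sup>2) (at t)"
      unfolding \<phi>_def
      by (auto intro!: derivative_eq_intros GDERIV_along_line[OF grad])
    moreover have "gh (x + t *\<^sub>R d) \<bullet> d - gh x \<bullet> d \<le> L * t * (norm d)\<^sup>2"
    proof -
      have "gh (x + t *\<^sub>R d) \<bullet> d - gh x \<bullet> d \<le> norm (gh (x + t *\<^sub>R d) - gh x) * norm d"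
        unfolding inner_diff_left[symmetric] by (rule norm_cauchy_schwarz)
      also have "norm (gh (x + t *\<^sub>R d) - gh x) \<le> L * norm (t *\<^sub>R d)"
        using lipschitz_onD[OF lip, of "x + t *\<^sub>R d" x] by (simp add: dist_norm)
      finally show ?thesis
        using t by (simp add: power2_eq_square mult_right_mono algebra_simps)
    qed
    ultimately show "\<exists>y. (\<phi> has_real_derivative y) (at t) \<and> y \<le> 0"
      by (intro exI conjI) auto
  qed simp
  then show ?thesis by (simp add: \<phi>_def d_def)
qed

text \<open>At a unit vector the quadratic lower and upper bounds around 0 have the same linear
  part, so their curvatures compare.\<close>

lemma strong_convexity_le_lipschitz:
  fixes h :: "'a::euclidean_space \<Rightarrow> real"
  assumes "\<forall>w. GDERIV h w :> gh w" "L-lipschitz_on UNIV gh" "strongly_convex \<mu> (\<lambda>w. ereal (h w))"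
  shows "\<mu> \<le> L"
proof -
  obtain e :: 'a where "norm e = 1" using vector_choose_size[of 1] by auto
  then show ?thesis
    using gradient_strongly_convex[OF assms(1,3), of 0 e] lipschitz_gradient_descent[OF assms(1,2), of e 0]
    by simp
qed

text \<open>If \<open>f x\<close> were infinite, the subgradient inequality would fail at a point of
  the domain.\<close>

lemma subdiff_finite:
  assumes f: "proper_closed_convex f" and v: "v \<in> subdiff f x"
  obtains r where "f x = ereal r"
proof -
  obtain u where "f u \<noteq> \<infinity>" using f by (auto simp: proper_closed_convex_def)
  moreover have "f x \<noteq> -\<infinity>" using f by (auto simp: proper_closed_convex_def)
  moreover have "f x + ereal (v \<bullet> (u - x)) \<le> f u" using v by (simp add: subdiff_def)
  ultimately show ?thesis using that by (cases "f x") auto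
qed

section \<open>The accelerated linearized method\<close>

locale accelerated_ADMM =
  fixes f :: "real ^ 'm \<Rightarrow> ereal"
    and g :: "real ^ 'n \<Rightarrow> ereal"
    and h :: "real ^ 'n \<Rightarrow> real"
    and gh :: "real ^ 'n \<Rightarrow> real ^ 'n"
    and B :: "real ^ 'm ^ 'p"
    and C :: "real ^ 'n ^ 'p"
    and b :: "real ^ 'p"
    and P :: "real ^ 'm ^ 'm"
    and Q :: "real ^ 'n ^ 'n"
    and Lh \<mu>g \<mu>h \<gamma> \<eta> :: real
    and k0 :: int
    and y :: "nat \<Rightarrow> real ^ 'm"
    and z :: "nat \<Rightarrow> real ^ 'n"
    and l :: "nat \<Rightarrow> real ^ 'p"
    and ys :: "real ^ 'm"
    and zs :: "real ^ 'n"
    and ls :: "real ^ 'p"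
  assumes f: "proper_closed_convex f"
    and g: "proper_closed_convex g"
    and h_convex: "convex_on UNIV h"
    and h_grad: "\<forall>w. GDERIV h w :> gh w"
    and h_lipschitz: "Lh-lipschitz_on UNIV gh"
    and g_strong: "strongly_convex \<mu>g g"
    and h_strong: "strongly_convex \<mu>h (\<lambda>w. ereal (h w))"
    and \<mu>_pos: "\<mu>g + \<mu>h > 0"
    and \<gamma>: "\<gamma> > 0"
    and \<eta>: "\<eta> \<ge> 1"
    and P: "psd P"
    and Q_sym: "transpose Q = Q"
    and Q_lower: "loewner_le ((\<eta> * \<gamma>) *\<^sub>R (transpose C ** C)) Q"
    and Q_upper: "loewner_le Q (((\<mu>g + \<mu>h) / 2) *\<^sub>R mat 1)"
    and algorithm: "linearized_ADMM f g gh B C b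
          (\<lambda>k. real (k + 1) * \<gamma>)
          (\<lambda>k. real (k + 1) * \<gamma>)
          (\<lambda>k. (1 / real (k + 1)) *\<^sub>R P)
          (\<lambda>k. real (k + 1) *\<^sub>R (Q - \<gamma> *\<^sub>R (transpose C ** C)) + Lh *\<^sub>R mat 1)
          y z l"
    and k0: "k0 = k0_of Lh \<mu>g \<mu>h"
    and KKT: "KKT_point f g gh B C b ys zs ls"
begin

subsection \<open>The one-step inequality\<close>

text \<open>Indexed by the step, not by the iterate: the multiplier update of step \<open>k\<close>
  uses \<open>residual k\<close>.\<close>

definition residual :: "nat \<Rightarrow> real ^ 'p" where
  "residual k = B *v y (k + 1) + C *v z (k + 1) - b"

text \<open>The objective difference, computed in the reals. Since \<open>real_of_ereal\<close> maps
  infinite values to 0, it has this meaning only where \<open>f u\<close> and \<open>g w\<close> are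
  finite.\<close>

definition gap :: "real ^ 'm \<Rightarrow> real ^ 'n \<Rightarrow> real" where
  "gap u w = (real_of_ereal (f u) + real_of_ereal (g w) + h w)
     - (real_of_ereal (f ys) + real_of_ereal (g zs) + h zs)"

text \<open>The primal reference point is fixed at the KKT point and the multiplier stays free:
  \<open>ls\<close> gives monotonicity, another choice gives the ergodic rates.\<close>

definition potential :: "real ^ 'p \<Rightarrow> nat \<Rightarrow> real" where
  "potential v k = merit P Q \<gamma> Lh \<mu>g k0 k (y k) (z k) (l k) ys zs v"

lemma \<mu>h_le_Lh: "\<mu>h \<le> Lh"
  using strong_convexity_le_lipschitz[OF h_grad h_lipschitz h_strong] .

text \<open>The ceiling in \<open>k0\<close> enters the estimates through this inequality, which is
  what the comparison of the \<open>z\<close> weights in \<open>potential_step\<close>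
  needs.\<close>

lemma k0_bound: "2 * (Lh - \<mu>h) \<le> (real_of_int k0 - 1) * (\<mu>g + \<mu>h)"
proof -
  have "1 + 2 * (Lh - \<mu>h) / (\<mu>g + \<mu>h) \<le> real_of_int k0"
    unfolding k0 k0_of_def by (rule le_of_int_ceiling)
  with \<mu>_pos show ?thesis by (simp add: field_simps)
qed

lemma k0_ge_1: "1 \<le> real_of_int k0"
proof -
  have "0 \<le> (real_of_int k0 - 1) * (\<mu>g + \<mu>h)"
    using k0_bound \<mu>h_le_Lh by simp
  with \<mu>_pos show ?thesis by (simp add: zero_le_mult_iff)
qed

lemma feasible: "B *v ys + C *v zs = b"
  using KKT by (simp add: KKT_point_def)

lemma residual_eq: "residual k = B *v (y (k + 1) - ys) + C *v (z (k + 1) - zs)"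
  unfolding residual_def
  unfolding feasible[symmetric] by (simp add: matrix_vector_mult_diff_distrib)

text \<open>Solved for the old multiplier, so that rewriting leaves only \<open>l (k + 1)\<close>
  and the residual.\<close>

lemma multiplier_step: "k \<ge> 1 \<Longrightarrow> l k = l (k + 1) + (real (k + 1) * \<gamma>) *\<^sub>R residual k"
  using algorithm by (simp add: linearized_ADMM_def residual_def)

text \<open>The left side recurs on the right, so this equation and \<open>g_star\<close> are used
  for single substitutions or from right to left.\<close>

lemma f_star: "f ys = ereal (real_of_ereal (f ys))"
proof -
  obtain r where "f ys = ereal r"
    using KKT subdiff_finite[OF f] unfolding KKT_point_def by metis
  then show ?thesis by simp
qed

lemma g_star: "g zs = ereal (real_of_ereal (g zs))"
proof -
  obtain r where "g zs = ereal r"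
    using KKT subdiff_finite[OF g] unfolding KKT_point_def by blast
  then show ?thesis by simp
qed

lemma objective_star:
  "objective f g h ys zs = ereal (real_of_ereal (f ys) + real_of_ereal (g zs) + h zs)"
  unfolding objective_def by (subst f_star, subst g_star) simp

lemma f_ninf: "f u \<noteq> -\<infinity>" and g_ninf: "g w \<noteq> -\<infinity>"
  using f g by (auto simp: proper_closed_convex_def)

text \<open>Add the subgradient inequalities of \<open>f\<close>, \<open>g\<close> and
  \<open>h\<close> at the KKT point. Stationarity and feasibility combine the linear terms into
  \<open>ls\<close> paired with the constraint violation; \<open>g\<close> and \<open>h\<close>
  contribute the quadratic term.\<close>

lemma gap_lower:
  assumes "f u \<noteq> \<infinity>" "g w \<noteq> \<infinity>"
  shows "ls \<bullet> (B *v u + C *v w - b) + (\<mu>g + \<mu>h) / 2 * (norm (w - zs))\<^sup>2 \<le> gap u w"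
proof -
  obtain s where s: "f u = ereal s" using assms f_ninf[of u] by (cases "f u") auto
  obtain t where t: "g w = ereal t" using assms g_ninf[of w] by (cases "g w") auto
  have "ereal (real_of_ereal (f ys)) + ereal ((transpose B *v ls) \<bullet> (u - ys)) \<le> f u"
    using KKT by (subst f_star[symmetric]) (simp add: KKT_point_def subdiff_def)
  then have 1: "real_of_ereal (f ys) + (transpose B *v ls) \<bullet> (u - ys) \<le> s"
    by (simp add: s)
  obtain v where v: "v \<in> subdiff g zs" "transpose C *v ls = v + gh zs"
    using KKT unfolding KKT_point_def by auto
  have "ereal (real_of_ereal (g zs)) + ereal (v \<bullet> (w - zs) + \<mu>g / 2 * (norm (w - zs))\<^sup>2) \<le> g w"
    using subdiff_strongly_convex[OF g_strong g_star v(1)] by (subst g_star[symmetric])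
  then have 2: "real_of_ereal (g zs) + v \<bullet> (w - zs) + \<mu>g / 2 * (norm (w - zs))\<^sup>2 \<le> t"
    by (simp add: t)
  have 3: "h zs + gh zs \<bullet> (w - zs) + \<mu>h / 2 * (norm (w - zs))\<^sup>2 \<le> h w"
    by (rule gradient_strongly_convex[OF h_grad h_strong])
  have "(transpose C *v ls) \<bullet> (w - zs) = v \<bullet> (w - zs) + gh zs \<bullet> (w - zs)"
    by (simp only: v(2) inner_add_left)
  moreover have "(transpose B *v ls) \<bullet> (u - ys) + (transpose C *v ls) \<bullet> (w - zs)
      = ls \<bullet> (B *v u + C *v w - b)"
    unfolding inner_transpose_mult feasible[symmetric]
    by (simp add: matrix_vector_mult_diff_distrib inner_diff_right inner_add_right)
  moreover have "(\<mu>g + \<mu>h) / 2 * (norm (w - zs))\<^sup>2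
      = \<mu>g / 2 * (norm (w - zs))\<^sup>2 + \<mu>h / 2 * (norm (w - zs))\<^sup>2"
    by (simp add: algebra_simps)
  ultimately show ?thesis
    unfolding gap_def s t real_of_ereal.simps using 1 2 3 by linarith
qed

text \<open>Optimality of the subproblem is tested at \<open>ys\<close>. Its penalty contains the
  old \<open>z k\<close> but the multiplier update contains \<open>z (k + 1)\<close>, which leaves a
  correction in \<open>C *v (z (k + 1) - z k)\<close> next to \<open>l (k + 1)\<close>.\<close>

lemma y_step:
  assumes "k \<ge> 1"
  shows "f (y (k + 1)) \<noteq> \<infinity>"
    and "real_of_ereal (f (y (k + 1))) - real_of_ereal (f ys)
      \<le> (l (k + 1) + (real (k + 1) * \<gamma>) *\<^sub>R (C *v (z (k + 1) - z k))) \<bullet> (B *v (y (k + 1) - ys))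
        - (P *v (y (k + 1) - y k)) \<bullet> (y (k + 1) - ys) / real (k + 1)"
proof -
  let ?\<beta> = "real (k + 1) * \<gamma>"
  let ?W = "(1 / real (k + 1)) *\<^sub>R P"
  have W: "transpose ?W = ?W" using P by (simp add: psd_def transpose_scalar)
  \<comment> \<open>Brings the subproblem into the shape expected by
    \<open>prox_step_subgradient\<close>.\<close>
  have eq: "- (l k \<bullet> (B *v u)) = (- (transpose B *v l k)) \<bullet> u"
      "B *v u + C *v z k - b = B *v u + (C *v z k - b)" for u
    by (simp_all add: dot_lmul_matrix)
  have "is_arg_min (\<lambda>u. f u + ereal (- (l k \<bullet> (B *v u))
                 + ?\<beta> / 2 * (norm (B *v u + C *v z k - b))\<^sup>2
                 + 1 / 2 * wnorm2 ?W (u - y k))) (\<lambda>_. True) (y (k + 1))"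
    using algorithm assms unfolding linearized_ADMM_def by blast
  then obtain r where r: "f (y (k + 1)) = ereal r"
    and opt: "\<And>u. f (y (k + 1)) + ereal (- (- (transpose B *v l k)
         + transpose B *v (?\<beta> *\<^sub>R (B *v y (k + 1) + (C *v z k - b))) + ?W *v (y (k + 1) - y k)) \<bullet> (u - y (k + 1))
            + 0 / 2 * (norm (u - y (k + 1)))\<^sup>2) \<le> f u"
    unfolding eq
    using prox_step_subgradient[OF proper_closed_convex_imp_strongly_convex[OF f] f W] by blast
  show "f (y (k + 1)) \<noteq> \<infinity>" using r by simp
  have flip: "ys - y (k + 1) = - (y (k + 1) - ys)" by simp
  have "?\<beta> *\<^sub>R (B *v y (k + 1) + (C *v z k - b))
      = l k - (l (k + 1) + ?\<beta> *\<^sub>R (C *v (z (k + 1) - z k)))"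
    unfolding multiplier_step[OF assms] residual_def
    by (simp add: matrix_vector_mult_diff_distrib algebra_simps)
  then have v: "- (transpose B *v l k) + transpose B *v (?\<beta> *\<^sub>R (B *v y (k + 1) + (C *v z k - b)))
       = - (transpose B *v (l (k + 1) + ?\<beta> *\<^sub>R (C *v (z (k + 1) - z k))))"
    by (simp only: matrix_vector_mult_diff_distrib) simp
  have "ereal r + ereal (- (- (transpose B *v (l (k + 1) + ?\<beta> *\<^sub>R (C *v (z (k + 1) - z k))))
       + ?W *v (y (k + 1) - y k)) \<bullet> (ys - y (k + 1))) \<le> ereal (real_of_ereal (f ys))"
    using opt[of ys] unfolding v r f_star[symmetric] by simp
  then have "r - (- (transpose B *v (l (k + 1) + ?\<beta> *\<^sub>R (C *v (z (k + 1) - z k))))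
       + ?W *v (y (k + 1) - y k)) \<bullet> (ys - y (k + 1)) \<le> real_of_ereal (f ys)"
    by (simp only: plus_ereal.simps ereal_less_eq inner_minus_left)
  moreover have "(- (transpose B *v (l (k + 1) + ?\<beta> *\<^sub>R (C *v (z (k + 1) - z k))))
       + ?W *v (y (k + 1) - y k)) \<bullet> (ys - y (k + 1))
     = (l (k + 1) + ?\<beta> *\<^sub>R (C *v (z (k + 1) - z k))) \<bullet> (B *v (y (k + 1) - ys))
        - (P *v (y (k + 1) - y k)) \<bullet> (y (k + 1) - ys) / real (k + 1)"
    unfolding flip inner_add_left inner_minus_left inner_minus_right
      scaleR_matrix_vector_assoc[symmetric] inner_scaleR_left inner_transpose_mult by simp
  ultimately show "real_of_ereal (f (y (k + 1))) - real_of_ereal (f ys)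
      \<le> (l (k + 1) + ?\<beta> *\<^sub>R (C *v (z (k + 1) - z k))) \<bullet> (B *v (y (k + 1) - ys))
        - (P *v (y (k + 1) - y k)) \<bullet> (y (k + 1) - ys) / real (k + 1)"
    unfolding r real_of_ereal.simps by linarith
qed

text \<open>Here the penalty already contains the new \<open>z\<close>, so the old multiplier and
  the penalty gradient combine exactly to \<open>l (k + 1)\<close>. The part of the proximal matrix
  in \<open>transpose C ** C\<close> yields a term that cancels the matching part of the correction
  in \<open>y_step\<close>.\<close>

lemma z_step:
  assumes "k \<ge> 1"
  shows "g (z (k + 1)) \<noteq> \<infinity>"
    and "real_of_ereal (g (z (k + 1))) - real_of_ereal (g zs)
      \<le> l (k + 1) \<bullet> (C *v (z (k + 1) - zs)) - gh (z k) \<bullet> (z (k + 1) - zs)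
        - real (k + 1) * ((Q *v (z (k + 1) - z k)) \<bullet> (z (k + 1) - zs))
        + real (k + 1) * \<gamma> * ((C *v (z (k + 1) - z k)) \<bullet> (C *v (z (k + 1) - zs)))
        - Lh * ((z (k + 1) - z k) \<bullet> (z (k + 1) - zs)) - \<mu>g / 2 * (norm (z (k + 1) - zs))\<^sup>2"
proof -
  let ?\<beta> = "real (k + 1) * \<gamma>"
  let ?W = "real (k + 1) *\<^sub>R (Q - \<gamma> *\<^sub>R (transpose C ** C)) + Lh *\<^sub>R mat 1"
  define e d where "e = z (k + 1) - zs" and "d = z (k + 1) - z k"
  have W: "transpose ?W = ?W"
    using Q_sym by (simp add: transpose_scalar transpose_def vec_eq_iff matrix_matrix_mult_def mat_def mult.commute)
  have eq: "B *v u + C *v w - b = C *v w + (B *v u - b)" for u w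
    by simp
  have "is_arg_min (\<lambda>w. g w + ereal ((gh (z k) - transpose C *v l k) \<bullet> w
                 + ?\<beta> / 2 * (norm (B *v y (k + 1) + C *v w - b))\<^sup>2
                 + 1 / 2 * wnorm2 ?W (w - z k))) (\<lambda>_. True) (z (k + 1))"
    using algorithm assms unfolding linearized_ADMM_def by blast
  then obtain r where r: "g (z (k + 1)) = ereal r"
    and opt: "\<And>u. g (z (k + 1)) + ereal (- ((gh (z k) - transpose C *v l k)
         + transpose C *v (?\<beta> *\<^sub>R (C *v z (k + 1) + (B *v y (k + 1) - b))) + ?W *v (z (k + 1) - z k)) \<bullet> (u - z (k + 1))
            + \<mu>g / 2 * (norm (u - z (k + 1)))\<^sup>2) \<le> g u"
    unfolding eq using prox_step_subgradient[OF g_strong g W] by blast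
  show "g (z (k + 1)) \<noteq> \<infinity>" using r by simp
  have "?\<beta> *\<^sub>R (C *v z (k + 1) + (B *v y (k + 1) - b)) = l k - l (k + 1)"
    unfolding multiplier_step[OF assms] residual_def by (simp add: algebra_simps)
  then have v: "(gh (z k) - transpose C *v l k) + transpose C *v (?\<beta> *\<^sub>R (C *v z (k + 1) + (B *v y (k + 1) - b)))
       = gh (z k) - transpose C *v l (k + 1)"
    by (simp only: matrix_vector_mult_diff_distrib) simp
  have "ereal r + ereal (- (gh (z k) - transpose C *v l (k + 1) + ?W *v d) \<bullet> (- e)
       + \<mu>g / 2 * (norm e)\<^sup>2) \<le> ereal (real_of_ereal (g zs))"
    using opt[of zs] unfolding v r g_star[symmetric] by (simp add: e_def d_def norm_minus_commute)
  then have "r + (gh (z k) - transpose C *v l (k + 1) + ?W *v d) \<bullet> e + \<mu>g / 2 * (norm e)\<^sup>2 \<le> real_of_ereal (g zs)"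
    by (simp only: plus_ereal.simps ereal_less_eq inner_minus_left inner_minus_right)
  moreover have "(?W *v d) \<bullet> e
      = real (k + 1) * ((Q *v d) \<bullet> e) - ?\<beta> * ((C *v d) \<bullet> (C *v e)) + Lh * (d \<bullet> e)"
  proof -
    have "?W *v d = real (k + 1) *\<^sub>R (Q *v d - \<gamma> *\<^sub>R (transpose C *v (C *v d))) + Lh *\<^sub>R d"
      by (simp only: matrix_vector_mult_add_rdistrib matrix_vector_mult_diff_rdistrib
        scaleR_matrix_vector_assoc[symmetric] matrix_vector_mul_assoc matrix_vector_mul_lid)
    then show ?thesis
      by (simp only: inner_add_left inner_diff_left inner_scaleR_left inner_transpose_mult)
        (simp add: algebra_simps)
  qed
  ultimately show "real_of_ereal (g (z (k + 1))) - real_of_ereal (g zs)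
      \<le> l (k + 1) \<bullet> (C *v (z (k + 1) - zs)) - gh (z k) \<bullet> (z (k + 1) - zs)
        - real (k + 1) * ((Q *v (z (k + 1) - z k)) \<bullet> (z (k + 1) - zs))
        + ?\<beta> * ((C *v (z (k + 1) - z k)) \<bullet> (C *v (z (k + 1) - zs)))
        - Lh * ((z (k + 1) - z k) \<bullet> (z (k + 1) - zs)) - \<mu>g / 2 * (norm (z (k + 1) - zs))\<^sup>2"
    unfolding e_def[symmetric] d_def[symmetric] r
    by (simp add: inner_add_left inner_diff_left inner_transpose_mult[symmetric] del: transpose_matrix_vector)
qed

lemma wnorm2_Q_bounds:
  "\<eta> * \<gamma> * (norm (C *v v))\<^sup>2 \<le> wnorm2 Q v" "wnorm2 Q v \<le> (\<mu>g + \<mu>h) / 2 * (norm v)\<^sup>2"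
  using loewner_le_wnorm2[OF Q_lower, of v] loewner_le_wnorm2[OF Q_upper, of v]
  by (simp_all only: wnorm2_gram wnorm2_scaled_identity)

lemma wnorm2_Q_nonneg: "0 \<le> wnorm2 Q v"
  using wnorm2_Q_bounds(1)[of v] \<eta> \<gamma> by (smt (verit) mult_nonneg_nonneg zero_le_power2)

lemma wnorm2_P_nonneg: "0 \<le> wnorm2 P v"
  using P by (simp add: psd_def wnorm2_def)

text \<open>When the bounds for \<open>f\<close>, \<open>g\<close> and \<open>h\<close> are added,
  the pairings of \<open>l (k + 1)\<close> with \<open>C *v e\<close> cancel, and so do the squares
  of \<open>norm d\<close> from the descent inequality and from the proximal term. One cross term of
  \<open>C *v d\<close> with \<open>r\<close> remains for Young's inequality.\<close>

lemma one_step: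
  assumes k: "k \<ge> 1"
  defines "\<kappa> \<equiv> real (k + 1)"
  shows "gap (y (k + 1)) (z (k + 1)) - v \<bullet> residual k + (1 - 1 / \<eta>) * (\<kappa> * \<gamma>) / 2 * (norm (residual k))\<^sup>2
    \<le> ((norm (v - l k))\<^sup>2 - (norm (v - l (k + 1)))\<^sup>2) / (2 * \<gamma> * \<kappa>)
      + (wnorm2 P (y k - ys) - wnorm2 P (y (k + 1) - ys)) / (2 * \<kappa>)
      + \<kappa> / 2 * (wnorm2 Q (z k - zs) - wnorm2 Q (z (k + 1) - zs))
      + (Lh - \<mu>h) / 2 * (norm (z k - zs))\<^sup>2 - (Lh + \<mu>g) / 2 * (norm (z (k + 1) - zs))\<^sup>2"
proof -
  define r d e where "r = residual k" and "d = z (k + 1) - z k" and "e = z (k + 1) - zs"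
  have \<kappa>: "\<kappa> > 0" by (simp add: \<kappa>_def)
  have Bey: "B *v (y (k + 1) - ys) = r - C *v e"
    by (simp add: r_def e_def residual_eq)
  have f': "real_of_ereal (f (y (k + 1))) - real_of_ereal (f ys)
      \<le> l (k + 1) \<bullet> r - l (k + 1) \<bullet> (C *v e) + \<kappa> * \<gamma> * ((C *v d) \<bullet> r) - \<kappa> * \<gamma> * ((C *v d) \<bullet> (C *v e))
        - (P *v (y (k + 1) - y k)) \<bullet> (y (k + 1) - ys) / \<kappa>"
    using y_step(2)[OF k, folded \<kappa>_def d_def] unfolding Bey
    by (simp add: inner_add_left inner_diff_right algebra_simps)
  have g': "real_of_ereal (g (z (k + 1))) - real_of_ereal (g zs)
      \<le> l (k + 1) \<bullet> (C *v e) - gh (z k) \<bullet> e - \<kappa> * ((Q *v d) \<bullet> e) + \<kappa> * \<gamma> * ((C *v d) \<bullet> (C *v e))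
        - Lh * (d \<bullet> e) - \<mu>g / 2 * (norm e)\<^sup>2"
    using z_step(2)[OF k, folded \<kappa>_def d_def e_def] .
  \<comment> \<open>Descent from \<open>z k\<close> to \<open>z (k + 1)\<close> and strong convexity
    from \<open>z k\<close> to \<open>zs\<close> both use the gradient at \<open>z k\<close>, the
    one that occurs in the linearized step.\<close>
  have h': "h (z (k + 1)) - h zs \<le> gh (z k) \<bullet> e + Lh / 2 * (norm d)\<^sup>2 - \<mu>h / 2 * (norm (z k - zs))\<^sup>2"
  proof -
    have "h (z (k + 1)) \<le> h (z k) + gh (z k) \<bullet> d + Lh / 2 * (norm d)\<^sup>2"
      unfolding d_def by (rule lipschitz_gradient_descent[OF h_grad h_lipschitz])
    moreover have "h (z k) + gh (z k) \<bullet> (zs - z k) + \<mu>h / 2 * (norm (z k - zs))\<^sup>2 \<le> h zs"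
      using gradient_strongly_convex[OF h_grad h_strong, of "z k" zs] by (simp add: norm_minus_commute)
    moreover have "gh (z k) \<bullet> e = gh (z k) \<bullet> d - gh (z k) \<bullet> (zs - z k)"
      by (simp add: d_def e_def inner_diff_right)
    ultimately show ?thesis by simp
  qed
  have P': "(P *v (y (k + 1) - y k)) \<bullet> (y (k + 1) - ys) / \<kappa>
      \<ge> (wnorm2 P (y (k + 1) - ys) - wnorm2 P (y k - ys)) / (2 * \<kappa>)"
    using wnorm2_three_point[of P "y (k + 1)" "y k" ys] P wnorm2_P_nonneg[of "y (k + 1) - y k"] \<kappa>
    by (simp add: psd_def divide_simps)
  have Q': "\<kappa> * ((Q *v d) \<bullet> e) = \<kappa> / 2 * (wnorm2 Q e + wnorm2 Q d - wnorm2 Q (z k - zs))"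
    using wnorm2_three_point[OF Q_sym, of "z (k + 1)" "z k" zs] by (simp add: d_def e_def)
  have L': "Lh * (d \<bullet> e) = Lh / 2 * ((norm e)\<^sup>2 + (norm d)\<^sup>2 - (norm (z k - zs))\<^sup>2)"
  proof -
    have "z k - zs = e - d" by (simp add: d_def e_def)
    then show ?thesis
      by (simp add: power2_norm_eq_inner inner_diff_left inner_diff_right inner_commute)
  qed
  \<comment> \<open>Expansion of the squared distance around \<open>l (k + 1)\<close>; the negative
    residual square pays for Young's inequality and leaves the slack.\<close>
  have l': "(l (k + 1) - v) \<bullet> r
      = ((norm (v - l k))\<^sup>2 - (norm (v - l (k + 1)))\<^sup>2) / (2 * \<gamma> * \<kappa>) - \<kappa> * \<gamma> / 2 * (norm r)\<^sup>2"
  proof -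
    define m where "m = v - l (k + 1)"
    have lk: "v - l k = m - (\<kappa> * \<gamma>) *\<^sub>R r" and lv: "l (k + 1) - v = - m"
      by (simp_all add: multiplier_step[OF k] \<kappa>_def r_def m_def)
    have "(norm (v - l k))\<^sup>2
        = (norm m)\<^sup>2 + 2 * (\<kappa> * \<gamma>) * ((l (k + 1) - v) \<bullet> r) + (\<kappa> * \<gamma>)\<^sup>2 * (norm r)\<^sup>2"
      unfolding lk lv power2_norm_eq_inner by (simp add: inner_diff_left inner_diff_right inner_commute
          power2_eq_square algebra_simps)
    with \<kappa> \<gamma> show ?thesis unfolding m_def[symmetric] by (simp add: field_simps power2_eq_square)
  qed
  \<comment> \<open>The weight \<open>\<eta>\<close> makes the first half exactly what the lower
    bound on \<open>Q\<close> absorbs, and leaves the fraction \<open>1 / \<eta>\<close> of the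
    residual square.\<close>
  have young: "\<kappa> * \<gamma> * ((C *v d) \<bullet> r) \<le> \<kappa> / 2 * wnorm2 Q d + \<kappa> * \<gamma> / (2 * \<eta>) * (norm r)\<^sup>2"
  proof -
    have "0 \<le> (\<eta> *\<^sub>R (C *v d) - r) \<bullet> (\<eta> *\<^sub>R (C *v d) - r)" by simp
    then have "2 * \<eta> * ((C *v d) \<bullet> r) \<le> \<eta>\<^sup>2 * (norm (C *v d))\<^sup>2 + (norm r)\<^sup>2"
      unfolding power2_norm_eq_inner by (simp add: inner_diff_left inner_diff_right inner_commute
          power2_eq_square algebra_simps)
    then have "(C *v d) \<bullet> r \<le> \<eta> / 2 * (norm (C *v d))\<^sup>2 + 1 / (2 * \<eta>) * (norm r)\<^sup>2"
      using \<eta> by (simp add: field_simps power2_eq_square)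
    then have "\<kappa> * \<gamma> * ((C *v d) \<bullet> r) \<le> \<kappa> * \<gamma> * (\<eta> / 2 * (norm (C *v d))\<^sup>2 + 1 / (2 * \<eta>) * (norm r)\<^sup>2)"
      using \<kappa> \<gamma> by (intro mult_left_mono) auto
    moreover have "\<kappa> / 2 * (\<eta> * \<gamma> * (norm (C *v d))\<^sup>2) \<le> \<kappa> / 2 * wnorm2 Q d"
      using \<kappa> by (intro mult_left_mono wnorm2_Q_bounds) auto
    ultimately show ?thesis by (simp add: algebra_simps)
  qed
  have s1: "(1 - 1 / \<eta>) * (\<kappa> * \<gamma>) / 2 * (norm r)\<^sup>2
      = \<kappa> * \<gamma> / 2 * (norm r)\<^sup>2 - \<kappa> * \<gamma> / (2 * \<eta>) * (norm r)\<^sup>2"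
    by (simp add: left_diff_distrib diff_divide_distrib)
  have s2: "(l (k + 1) - v) \<bullet> r = l (k + 1) \<bullet> r - v \<bullet> r" by (rule inner_diff_left)
  have s3: "(wnorm2 P (y k - ys) - wnorm2 P (y (k + 1) - ys)) / (2 * \<kappa>)
      = - ((wnorm2 P (y (k + 1) - ys) - wnorm2 P (y k - ys)) / (2 * \<kappa>))"
    by (simp add: minus_divide_left)
  show ?thesis
    unfolding gap_def r_def[symmetric] e_def[symmetric] s1 s3
    using f' g' h' P' Q' L' l'[unfolded s2] young
    by (simp add: algebra_simps add_divide_distrib diff_divide_distrib)
qed

text \<open>Multiply \<open>one_step\<close> by \<open>k + 1 + k0\<close>. The terms at index
  \<open>k + 1\<close> then cancel the new potential exactly, and those at index \<open>k\<close>
  are dominated by the old one.\<close>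

lemma potential_step:
  assumes k: "k \<ge> 1"
  shows "(real k + real_of_int k0 + 1)
      * (gap (y (k + 1)) (z (k + 1)) - v \<bullet> residual k
         + (1 - 1 / \<eta>) * (real (k + 1) * \<gamma>) / 2 * (norm (residual k))\<^sup>2)
      + potential v (k + 1) \<le> potential v k"
proof -
  define \<kappa> K where "\<kappa> = real (k + 1)" and "K = real_of_int k0"
  define a0 a1 p0 p1 q0 q1 n0 n1 where "a0 = (norm (v - l k))\<^sup>2" and "a1 = (norm (v - l (k + 1)))\<^sup>2"
    and "p0 = wnorm2 P (y k - ys)" and "p1 = wnorm2 P (y (k + 1) - ys)"
    and "q0 = wnorm2 Q (z k - zs)" and "q1 = wnorm2 Q (z (k + 1) - zs)"
    and "n0 = (norm (z k - zs))\<^sup>2" and "n1 = (norm (z (k + 1) - zs))\<^sup>2"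
  have pos: "\<kappa> \<ge> 2" "K \<ge> 1" "\<gamma> > 0"
    using k k0_ge_1 \<gamma> by (auto simp: \<kappa>_def K_def)
  have nn: "0 \<le> a0" "0 \<le> p0" "0 \<le> n0" using wnorm2_P_nonneg by (auto simp: a0_def p0_def n0_def)
  have q0: "q0 \<le> (\<mu>g + \<mu>h) / 2 * n0"
    using wnorm2_Q_bounds(2) by (simp add: q0_def n0_def)
  have KK: "2 * (Lh - \<mu>h) \<le> (K - 1) * (\<mu>g + \<mu>h)" using k0_bound by (simp add: K_def)
  define S where "S = gap (y (k + 1)) (z (k + 1)) - v \<bullet> residual k
         + (1 - 1 / \<eta>) * (\<kappa> * \<gamma>) / 2 * (norm (residual k))\<^sup>2"
  define R where "R = (a0 - a1) / (2 * \<gamma> * \<kappa>) + (p0 - p1) / (2 * \<kappa>) + \<kappa> / 2 * (q0 - q1)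
      + (Lh - \<mu>h) / 2 * n0 - (Lh + \<mu>g) / 2 * n1"
  have "S \<le> R"
    unfolding S_def R_def a0_def a1_def p0_def p1_def q0_def q1_def n0_def n1_def \<kappa>_def
    by (rule one_step[OF k])
  then have "(\<kappa> + K) * S \<le> (\<kappa> + K) * R" using pos by (intro mult_left_mono) auto
  moreover have "(\<kappa> + K) * R + potential v (k + 1) \<le> potential v k"
  proof -
    \<comment> \<open>Here \<open>k = \<kappa> - 1\<close>. These are the weights of the
      \<open>y\<close> part at \<open>k\<close> and \<open>k + 1\<close>, and after division by
      \<open>\<gamma>\<close> those of the multiplier part; each is \<open>1 / 2\<close> plus
      \<open>K\<close> over twice the index, hence decreasing.\<close>
    define c0 c1 where "c0 = (\<kappa> - 1 + K) / (2 * (\<kappa> - 1))" and "c1 = (\<kappa> + K) / (2 * \<kappa>)"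
    have c: "c1 \<le> c0" using pos by (simp add: c0_def c1_def field_simps)
    have \<phi>0: "potential v k = c0 * p0 + (\<kappa> - 1 + K) / 2 * ((\<kappa> - 1) * q0 + (Lh + \<mu>g) * n0) + c0 * a0 / \<gamma>"
      by (simp add: potential_def merit_def p0_def q0_def n0_def a0_def c0_def \<kappa>_def K_def mult_ac)
    have \<phi>1: "potential v (k + 1) = c1 * p1 + (\<kappa> + K) / 2 * (\<kappa> * q1 + (Lh + \<mu>g) * n1) + c1 * a1 / \<gamma>"
      by (simp add: potential_def merit_def p1_def q1_def n1_def a1_def c1_def \<kappa>_def K_def mult_ac)
    have R: "(\<kappa> + K) * R = c1 * (a0 - a1) / \<gamma> + c1 * (p0 - p1)
        + (\<kappa> + K) / 2 * (\<kappa> * q0 - \<kappa> * q1 + (Lh - \<mu>h) * n0 - (Lh + \<mu>g) * n1)"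
      by (simp add: R_def c1_def algebra_simps add_divide_distrib diff_divide_distrib)
    have "c1 * p0 \<le> c0 * p0" using c nn by (intro mult_right_mono)
    moreover have "c1 * a0 / \<gamma> \<le> c0 * a0 / \<gamma>"
      using c nn pos by (intro divide_right_mono mult_right_mono) auto
    \<comment> \<open>The coefficient of \<open>q0\<close> on the left exceeds the one on the right
      by \<open>2 * \<kappa> + K - 1\<close>. Once \<open>q0\<close> is replaced by its upper bound,
      the terms growing with \<open>\<kappa>\<close> cancel and the inequality \<open>KK\<close> is
      what remains.\<close>
    moreover have "(\<kappa> + K) * (\<kappa> * q0 + (Lh - \<mu>h) * n0) \<le> (\<kappa> - 1 + K) * ((\<kappa> - 1) * q0 + (Lh + \<mu>g) * n0)"
    proof -
      have "(2 * \<kappa> + K - 1) * q0 \<le> (2 * \<kappa> + K - 1) * ((\<mu>g + \<mu>h) / 2 * n0)"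
        using q0 pos by (intro mult_left_mono) auto
      moreover have "2 * (Lh - \<mu>h) * n0 \<le> (K - 1) * (\<mu>g + \<mu>h) * n0"
        using KK nn by (intro mult_right_mono)
      ultimately show ?thesis by (simp add: field_simps)
    qed
    ultimately show ?thesis
      unfolding \<phi>0 \<phi>1 R by (simp add: algebra_simps add_divide_distrib diff_divide_distrib)
  qed
  moreover have "real k + real_of_int k0 + 1 = \<kappa> + K" by (simp add: \<kappa>_def K_def)
  ultimately show ?thesis unfolding S_def \<kappa>_def[symmetric] by simp
qed

subsection \<open>Rates of convergence\<close>

lemma Lh_\<mu>g_pos: "0 < Lh + \<mu>g"
  using \<mu>h_le_Lh \<mu>_pos by linarith

lemma iterate_finite: "k \<ge> 1 \<Longrightarrow> f (y (k + 1)) \<noteq> \<infinity>" "k \<ge> 1 \<Longrightarrow> g (z (k + 1)) \<noteq> \<infinity>"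
  by (rule y_step z_step; assumption)+

lemma objective_gap:
  assumes "f u \<noteq> \<infinity>" "g w \<noteq> \<infinity>"
  shows "objective f g h u w - objective f g h ys zs = ereal (gap u w)"
proof -
  obtain s where "f u = ereal s" using assms f_ninf[of u] by (cases "f u") auto
  moreover obtain t where "g w = ereal t" using assms g_ninf[of w] by (cases "g w") auto
  ultimately show ?thesis unfolding objective_star by (simp add: objective_def gap_def)
qed

text \<open>The potential is a sum of four nonnegative terms, so it dominates each of them.\<close>

lemma potential_nonneg_parts:
  assumes "k \<ge> 1"
  shows "(real k + real_of_int k0) / (2 * real k) * wnorm2 P (y k - ys) \<le> potential v k"
    and "(real k + real_of_int k0) / 2 * (real k * wnorm2 Q (z k - zs)) \<le> potential v k"
    and "(real k + real_of_int k0) / 2 * ((Lh + \<mu>g) * (norm (z k - zs))\<^sup>2) \<le> potential v k"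
    and "(real k + real_of_int k0) / (2 * \<gamma> * real k) * (norm (v - l k))\<^sup>2 \<le> potential v k"
proof -
  have "0 \<le> (real k + real_of_int k0) / (2 * real k) * wnorm2 P (y k - ys)"
    "0 \<le> (real k + real_of_int k0) / 2 * (real k * wnorm2 Q (z k - zs))"
    "0 \<le> (real k + real_of_int k0) / 2 * ((Lh + \<mu>g) * (norm (z k - zs))\<^sup>2)"
    "0 \<le> (real k + real_of_int k0) / (2 * \<gamma> * real k) * (norm (v - l k))\<^sup>2"
    using assms k0_ge_1 wnorm2_P_nonneg wnorm2_Q_nonneg \<gamma> Lh_\<mu>g_pos by auto
  then show "(real k + real_of_int k0) / (2 * real k) * wnorm2 P (y k - ys) \<le> potential v k"
    "(real k + real_of_int k0) / 2 * (real k * wnorm2 Q (z k - zs)) \<le> potential v k"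
    "(real k + real_of_int k0) / 2 * ((Lh + \<mu>g) * (norm (z k - zs))\<^sup>2) \<le> potential v k"
    "(real k + real_of_int k0) / (2 * \<gamma> * real k) * (norm (v - l k))\<^sup>2 \<le> potential v k"
    unfolding potential_def merit_def distrib_left[of "(real k + real_of_int k0) / 2"] by linarith+
qed

lemma potential_nonneg: "k \<ge> 1 \<Longrightarrow> 0 \<le> potential v k"
  using potential_nonneg_parts(2)[of k v] wnorm2_Q_nonneg[of "z k - zs"] k0_ge_1
  by (smt (verit) divide_nonneg_nonneg mult_nonneg_nonneg of_nat_0_le_iff)

lemma slack_nonneg: "0 \<le> (1 - 1 / \<eta>) * (real (k + 1) * \<gamma>) / 2 * (norm (residual k))\<^sup>2"
  using \<eta> \<gamma> by simp

text \<open>The strong convexity term is kept because it supplies the extra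
  \<open>\<mu>g + \<mu>h\<close> in the constant of \<open>z_rate\<close>.\<close>

lemma lagrangian_gap_lower:
  assumes "k \<ge> 1"
  shows "(\<mu>g + \<mu>h) / 2 * (norm (z (k + 1) - zs))\<^sup>2 \<le> gap (y (k + 1)) (z (k + 1)) - ls \<bullet> residual k"
  using gap_lower[OF iterate_finite[OF assms]] by (simp add: residual_def)

lemma lagrangian_gap_nonneg: "k \<ge> 1 \<Longrightarrow> 0 \<le> gap (y (k + 1)) (z (k + 1)) - ls \<bullet> residual k"
  by (rule order.trans[OF _ lagrangian_gap_lower]) (use \<mu>_pos in auto)

lemma potential_sum:
  "(\<Sum>k = 1..t. (real k + real_of_int k0 + 1)
      * (gap (y (k + 1)) (z (k + 1)) - v \<bullet> residual k
         + (1 - 1 / \<eta>) * (real (k + 1) * \<gamma>) / 2 * (norm (residual k))\<^sup>2))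
    + potential v (t + 1) \<le> potential v 1"
proof (induction t)
  case (Suc t)
  then show ?case using potential_step[of "Suc t" v] by simp
qed simp

lemma potential_star_decreasing: "potential ls (t + 1) \<le> potential ls 1"
proof -
  have "0 \<le> (\<Sum>k = 1..t. (real k + real_of_int k0 + 1)
      * (gap (y (k + 1)) (z (k + 1)) - ls \<bullet> residual k
         + (1 - 1 / \<eta>) * (real (k + 1) * \<gamma>) / 2 * (norm (residual k))\<^sup>2))"
    using k0_ge_1 by (intro sum_nonneg mult_nonneg_nonneg add_nonneg_nonneg lagrangian_gap_nonneg slack_nonneg) auto
  then show ?thesis using potential_sum[where v = ls and t = t] by simp
qed

lemma potential_star_le: "k \<ge> 1 \<Longrightarrow> potential ls k \<le> potential ls 1"
  using potential_star_decreasing[of "k - 1"] by simp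

text \<open>Discards the slack in \<open>potential_step\<close> at \<open>v = ls\<close> and uses
  monotonicity back to index 1.\<close>

lemma gap_upper:
  assumes "k \<ge> 1"
  shows "(real (k + 1) + real_of_int k0) * (gap (y (k + 1)) (z (k + 1)) - ls \<bullet> residual k)
    + potential ls (k + 1) \<le> potential ls 1"
proof -
  have "(real (k + 1) + real_of_int k0) * (gap (y (k + 1)) (z (k + 1)) - ls \<bullet> residual k)
    \<le> (real k + real_of_int k0 + 1) * (gap (y (k + 1)) (z (k + 1)) - ls \<bullet> residual k
         + (1 - 1 / \<eta>) * (real (k + 1) * \<gamma>) / 2 * (norm (residual k))\<^sup>2)"
    using k0_ge_1 slack_nonneg[of k] by (intro mult_mono lagrangian_gap_nonneg[OF assms]) auto
  then show ?thesis
    using potential_step[OF assms, of ls] potential_star_le[OF assms] by linarith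
qed

lemma z_rate_Q:
  assumes "k \<ge> 1"
  shows "wnorm2 Q (z k - zs) \<le> 2 * potential ls 1 / (real k * (real k + real_of_int k0))"
proof -
  have "(real k + real_of_int k0) / 2 * (real k * wnorm2 Q (z k - zs)) \<le> potential ls 1"
    using potential_nonneg_parts(2)[OF assms] potential_star_le[OF assms] by (rule order.trans)
  moreover have "0 < real k * (real k + real_of_int k0)" using assms k0_ge_1 by simp
  ultimately show ?thesis by (simp add: pos_le_divide_eq mult_ac)
qed

text \<open>The potential alone gives the constant \<open>Lh + \<mu>g\<close>; the Lagrangian gap at
  the same iterate adds \<open>\<mu>g + \<mu>h\<close>. The gap is controlled only for iterates
  produced by a step, hence the start at 2.\<close>

lemma z_rate:
  assumes "k \<ge> 2"
  shows "(norm (z k - zs))\<^sup>2 \<le> 2 * potential ls 1 / ((real k + real_of_int k0) * (Lh + \<mu>h + 2 * \<mu>g))"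
proof -
  define j where "j = k - 1"
  have k: "k = j + 1" and j: "j \<ge> 1" using assms by (auto simp: j_def)
  have "(real (j + 1) + real_of_int k0) * ((\<mu>g + \<mu>h) / 2 * (norm (z (j + 1) - zs))\<^sup>2)
      \<le> (real (j + 1) + real_of_int k0) * (gap (y (j + 1)) (z (j + 1)) - ls \<bullet> residual j)"
    using k0_ge_1 by (intro mult_left_mono lagrangian_gap_lower[OF j]) auto
  moreover have "(real (j + 1) + real_of_int k0) / 2 * ((Lh + \<mu>g) * (norm (z (j + 1) - zs))\<^sup>2)
      \<le> potential ls (j + 1)"
    by (rule potential_nonneg_parts) simp
  ultimately have "(real k + real_of_int k0) * ((\<mu>g + \<mu>h) / 2 * (norm (z k - zs))\<^sup>2)
      + (real k + real_of_int k0) / 2 * ((Lh + \<mu>g) * (norm (z k - zs))\<^sup>2) \<le> potential ls 1"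
    using gap_upper[OF j] unfolding k by linarith
  moreover have "0 < (real k + real_of_int k0) * (Lh + \<mu>h + 2 * \<mu>g)"
    using k0_ge_1 Lh_\<mu>g_pos \<mu>_pos by (intro mult_pos_pos) auto
  moreover have "(norm (z k - zs))\<^sup>2 * ((real k + real_of_int k0) * (Lh + \<mu>h + 2 * \<mu>g))
      = 2 * ((real k + real_of_int k0) * ((\<mu>g + \<mu>h) / 2 * (norm (z k - zs))\<^sup>2)
        + (real k + real_of_int k0) / 2 * ((Lh + \<mu>g) * (norm (z k - zs))\<^sup>2))"
    by (simp add: field_simps)
  ultimately show ?thesis by (simp add: pos_le_divide_eq)
qed

section \<open>Ergodic averages\<close>

lemma weight_sum:
  "(\<Sum>k = 1..t. real k + real_of_int k0 + 1) = real t * (real t + 2 * real_of_int k0 + 3) / 2"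
  by (induction t) (simp_all add: field_simps)

text \<open>Jensen's inequality bounds the gap at the averages by the averaged gap, while the
  residual, being affine, averages exactly. The weights are those of \<open>potential_sum\<close>,
  normalized by their sum \<open>W\<close>.\<close>

lemma ergodic_gap:
  assumes t: "t \<ge> 1"
  shows "f (ergodic k0 y t) \<noteq> \<infinity>" "g (ergodic k0 z t) \<noteq> \<infinity>"
    and "gap (ergodic k0 y t) (ergodic k0 z t)
        - v \<bullet> (B *v ergodic k0 y t + C *v ergodic k0 z t - b)
      \<le> 2 / (real t * (real t + 2 * real_of_int k0 + 3)) * potential v 1"
proof -
  define W where "W = (\<Sum>k = 1..t. real k + real_of_int k0 + 1)"
  define w where "w k = (real k + real_of_int k0 + 1) / W" for k
  have W: "W > 0" unfolding W_def weight_sum using t k0_ge_1 by simp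
  have w0: "0 \<le> w k" for k using W k0_ge_1 by (simp add: w_def)
  have w1: "(\<Sum>k = 1..t. w k) = 1"
    unfolding w_def sum_divide_distrib[symmetric] W_def[symmetric] using W by simp
  have erg: "ergodic k0 x t = (\<Sum>k = 1..t. w k *\<^sub>R x (k + 1))" for x :: "nat \<Rightarrow> 'a::real_vector"
    unfolding ergodic_def W_def[symmetric] w_def by (simp add: scaleR_sum_right divide_inverse mult.commute)
  have fy: "f (y (k + 1)) = ereal (real_of_ereal (f (y (k + 1))))" if "k \<in> {1..t}" for k
    using that iterate_finite(1)[of k] f_ninf[of "y (k + 1)"] by (cases "f (y (k + 1))") auto
  have gz: "g (z (k + 1)) = ereal (real_of_ereal (g (z (k + 1))))" if "k \<in> {1..t}" for k
    using that iterate_finite(2)[of k] g_ninf[of "z (k + 1)"] by (cases "g (z (k + 1))") auto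
  have F: "f (ergodic k0 y t) \<le> ereal (\<Sum>k = 1..t. w k * real_of_ereal (f (y (k + 1))))"
    unfolding erg by (rule proper_closed_convex_finite_Jensen[OF f _ w0 w1 fy]) auto
  have G: "g (ergodic k0 z t) \<le> ereal (\<Sum>k = 1..t. w k * real_of_ereal (g (z (k + 1))))"
    unfolding erg by (rule proper_closed_convex_finite_Jensen[OF g _ w0 w1 gz]) auto
  have H: "h (ergodic k0 z t) \<le> (\<Sum>k = 1..t. w k * h (z (k + 1)))"
    unfolding erg using w0 w1 t by (intro convex_on_sum[OF _ _ h_convex]) auto
  show "f (ergodic k0 y t) \<noteq> \<infinity>" "g (ergodic k0 z t) \<noteq> \<infinity>" using F G by auto
  have F': "real_of_ereal (f (ergodic k0 y t)) \<le> (\<Sum>k = 1..t. w k * real_of_ereal (f (y (k + 1))))"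
    using F f_ninf[of "ergodic k0 y t"] by (cases "f (ergodic k0 y t)") auto
  have G': "real_of_ereal (g (ergodic k0 z t)) \<le> (\<Sum>k = 1..t. w k * real_of_ereal (g (z (k + 1))))"
    using G g_ninf[of "ergodic k0 z t"] by (cases "g (ergodic k0 z t)") auto
  have const: "(\<Sum>k = 1..t. w k * c) = c" for c
    using w1 by (simp add: sum_distrib_right[symmetric])
  have gap': "gap (ergodic k0 y t) (ergodic k0 z t) \<le> (\<Sum>k = 1..t. w k * gap (y (k + 1)) (z (k + 1)))"
    unfolding gap_def right_diff_distrib distrib_left sum_subtractf sum.distrib const
    using F' G' H by simp
  have "(\<Sum>k = 1..t. w k *\<^sub>R b) = b"
    using w1 by (simp add: scaleR_sum_left[symmetric])
  then have res: "B *v ergodic k0 y t + C *v ergodic k0 z t - b = (\<Sum>k = 1..t. w k *\<^sub>R residual k)"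
    unfolding erg residual_def
    by (simp add: scaleR_diff_right scaleR_add_right sum_subtractf sum.distrib
        linear_sum[OF matrix_vector_mul_linear] matrix_vector_mult_scaleR)
  have "gap (ergodic k0 y t) (ergodic k0 z t) - v \<bullet> (B *v ergodic k0 y t + C *v ergodic k0 z t - b)
      \<le> (\<Sum>k = 1..t. w k * (gap (y (k + 1)) (z (k + 1)) - v \<bullet> residual k))"
    using gap' unfolding res by (simp add: inner_sum_right right_diff_distrib sum_subtractf)
  also have "\<dots> \<le> (\<Sum>k = 1..t. w k * (gap (y (k + 1)) (z (k + 1)) - v \<bullet> residual k
         + (1 - 1 / \<eta>) * (real (k + 1) * \<gamma>) / 2 * (norm (residual k))\<^sup>2))"
    by (intro sum_mono mult_left_mono w0) (use slack_nonneg in simp)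
  also have "\<dots> = (\<Sum>k = 1..t. (real k + real_of_int k0 + 1) * (gap (y (k + 1)) (z (k + 1)) - v \<bullet> residual k
         + (1 - 1 / \<eta>) * (real (k + 1) * \<gamma>) / 2 * (norm (residual k))\<^sup>2)) / W"
    unfolding sum_divide_distrib by (simp add: w_def)
  also have "\<dots> \<le> potential v 1 / W"
    using W potential_sum[of v t] potential_nonneg[of "t + 1" v] by (intro divide_right_mono) auto
  also have "\<dots> = 2 / (real t * (real t + 2 * real_of_int k0 + 3)) * potential v 1"
    unfolding W_def weight_sum by simp
  finally show "gap (ergodic k0 y t) (ergodic k0 z t)
        - v \<bullet> (B *v ergodic k0 y t + C *v ergodic k0 z t - b)
      \<le> 2 / (real t * (real t + 2 * real_of_int k0 + 3)) * potential v 1" .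
qed

text \<open>Since \<open>l 1 = 0\<close>, the multiplier enters the first potential only through its
  norm, so a bound for \<open>2 *\<^sub>R ls\<close> covers every shorter test multiplier.\<close>

lemma potential_1_mono:
  assumes "norm v \<le> norm v'"
  shows "potential v 1 \<le> potential v' 1"
proof -
  have "l 1 = 0" using algorithm by (simp add: linearized_ADMM_def)
  moreover have "(norm v)\<^sup>2 \<le> (norm v')\<^sup>2" using assms by (intro power_mono) auto
  ultimately show ?thesis
    unfolding potential_def merit_def using k0_ge_1 \<gamma> by (simp add: mult_left_mono divide_right_mono)
qed

text \<open>The test multiplier \<open>v\<close> has norm at most \<open>2 * norm ls\<close> and points against the averaged
  residual, so that the Lagrangian gap controls \<open>2 * norm ls\<close> times the residual.\<close>
lemma ergodic_rates:
  assumes t: "t \<ge> 1"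
  defines "E \<equiv> 2 / (real t * (real t + 2 * real_of_int k0 + 3)) * potential (2 *\<^sub>R ls) 1"
  shows "\<bar>gap (ergodic k0 y t) (ergodic k0 z t)\<bar> \<le> E"
    and "norm ls * norm (B *v ergodic k0 y t + C *v ergodic k0 z t - b) \<le> E"
proof -
  define r where "r = B *v ergodic k0 y t + C *v ergodic k0 z t - b"
  define G where "G = gap (ergodic k0 y t) (ergodic k0 z t)"
  define v where "v = - (2 * norm ls / norm r) *\<^sub>R r"
  \<comment> \<open>For \<open>r = 0\<close> the division by zero makes \<open>v = 0\<close>, and
    both facts still hold.\<close>
  have v: "norm v \<le> norm (2 *\<^sub>R ls)" "v \<bullet> r = - (2 * norm ls * norm r)"
    by (cases "r = 0"; simp add: v_def power2_norm_eq_inner[symmetric] power2_eq_square)+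
  have "G - v \<bullet> r \<le> 2 / (real t * (real t + 2 * real_of_int k0 + 3)) * potential v 1"
    unfolding G_def r_def by (rule ergodic_gap(3)[OF t])
  also have "\<dots> \<le> E"
    unfolding E_def using k0_ge_1 by (intro mult_left_mono potential_1_mono[OF v(1)]) auto
  finally have upper: "G + 2 * norm ls * norm r \<le> E" using v(2) by simp
  have "ls \<bullet> r \<le> G"
  proof -
    have "0 \<le> (\<mu>g + \<mu>h) / 2 * (norm (ergodic k0 z t - zs))\<^sup>2" using \<mu>_pos by simp
    then show ?thesis unfolding r_def G_def using gap_lower[OF ergodic_gap(1,2)[OF t]] by linarith
  qed
  moreover have "- (norm ls * norm r) \<le> ls \<bullet> r"
    using Cauchy_Schwarz_ineq2[of ls r] by linarith
  ultimately have lower: "- (norm ls * norm r) \<le> G" by linarith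
  \<comment> \<open>Adding \<open>upper\<close> and \<open>lower\<close> gives
    \<open>norm ls * norm r \<le> E\<close>, and then \<open>lower\<close> gives
    \<open>- E \<le> G\<close>. The factor 2 in the test multiplier provides this surplus.\<close>
  have nn: "0 \<le> norm ls * norm r" by simp
  show "\<bar>gap (ergodic k0 y t) (ergodic k0 z t)\<bar> \<le> E"
    and "norm ls * norm (B *v ergodic k0 y t + C *v ergodic k0 z t - b) \<le> E"
    unfolding r_def[symmetric] G_def[symmetric] using upper lower nn by linarith+
qed

section \<open>Boundedness and rates of the iterates themselves\<close>

lemma iterates_bounded:
  assumes "pd P"
  shows "bounded ((\<lambda>k. (y k, z k, l k)) ` {1..})"
proof -
  define \<Phi> where "\<Phi> = potential ls 1"
  obtain c where c: "c > 0" "\<And>v. c * (norm v)\<^sup>2 \<le> wnorm2 P v"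
    by (rule pd_coercive[OF assms]) (rule that)
  have bdd: "bounded (x ` {1..})" if "\<And>k. k \<ge> 1 \<Longrightarrow> a * (norm (x k - xs))\<^sup>2 \<le> \<Phi>" "a > 0"
    for x :: "nat \<Rightarrow> 'a::real_normed_vector" and xs a
  proof (rule boundedI)
    fix u assume "u \<in> x ` {1..}"
    then obtain k where k: "k \<ge> 1" "u = x k" by auto
    have "(norm (x k - xs))\<^sup>2 \<le> \<Phi> / a" using that(1)[OF k(1)] \<open>a > 0\<close> by (simp add: field_simps)
    then have "norm (x k - xs) \<le> sqrt (\<Phi> / a)" by (rule real_le_rsqrt)
    then show "norm u \<le> norm xs + sqrt (\<Phi> / a)"
      using norm_triangle_sub[of "x k" xs] k by simp
  qed
  \<comment> \<open>The weights of the \<open>y\<close> and multiplier terms do not degenerate as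
    \<open>k\<close> grows, so a bounded potential bounds these distances uniformly.\<close>
  have half: "1 / 2 \<le> (real k + real_of_int k0) / (2 * real k)" if "k \<ge> 1" for k
    using that k0_ge_1 by (simp add: field_simps)
  have "bounded (y ` {1..})"
  proof (rule bdd)
    fix k :: nat assume k: "k \<ge> 1"
    have "c / 2 * (norm (y k - ys))\<^sup>2 \<le> 1 / 2 * wnorm2 P (y k - ys)" using c(2) by simp
    also have "\<dots> \<le> (real k + real_of_int k0) / (2 * real k) * wnorm2 P (y k - ys)"
      by (intro mult_right_mono half[OF k] wnorm2_P_nonneg)
    also have "\<dots> \<le> potential ls k" by (rule potential_nonneg_parts(1)[OF k])
    also have "\<dots> \<le> \<Phi>" unfolding \<Phi>_def by (rule potential_star_le[OF k])
    finally show "c / 2 * (norm (y k - ys))\<^sup>2 \<le> \<Phi>" .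
  qed (use c in simp)
  moreover have "bounded (z ` {1..})"
  proof (rule bdd)
    fix k :: nat assume k: "k \<ge> 1"
    have "1 * ((Lh + \<mu>g) * (norm (z k - zs))\<^sup>2)
        \<le> (real k + real_of_int k0) / 2 * ((Lh + \<mu>g) * (norm (z k - zs))\<^sup>2)"
      using k k0_ge_1 Lh_\<mu>g_pos by (intro mult_right_mono) auto
    then show "(Lh + \<mu>g) * (norm (z k - zs))\<^sup>2 \<le> \<Phi>"
      using potential_nonneg_parts(3)[OF k, of ls] potential_star_le[OF k] by (simp add: \<Phi>_def)
  qed (rule Lh_\<mu>g_pos)
  moreover have "bounded (l ` {1..})"
  proof (rule bdd)
    fix k :: nat assume k: "k \<ge> 1"
    have "1 / (2 * \<gamma>) * (norm (l k - ls))\<^sup>2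
        \<le> (real k + real_of_int k0) / (2 * real k) / \<gamma> * (norm (l k - ls))\<^sup>2"
      using divide_right_mono[OF half[OF k], of \<gamma>] \<gamma> by (intro mult_right_mono) auto
    then show "1 / (2 * \<gamma>) * (norm (l k - ls))\<^sup>2 \<le> \<Phi>"
      using potential_nonneg_parts(4)[OF k, of ls] potential_star_le[OF k]
      by (simp add: \<Phi>_def norm_minus_commute mult_ac)
  qed (use \<gamma> in simp)
  ultimately have "bounded (y ` {1..} \<times> z ` {1..} \<times> l ` {1..})"
    by (intro bounded_Times)
  then show ?thesis by (rule bounded_subset) auto
qed

text \<open>The slack in the telescoped sum at \<open>v = ls\<close> dominates \<open>c\<close>
  times the squared sequence, with \<open>c > 0\<close> because \<open>\<eta> > 1\<close>. The
  squares are therefore summable and tend to 0.\<close>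

lemma residual_rate:
  assumes "\<eta> > 1"
  shows "(\<lambda>k. real (k + 1) * norm (residual k)) \<longlonglongrightarrow> 0"
proof -
  define c where "c = (1 - 1 / \<eta>) * \<gamma> / 2"
  define a where "a k = c * (real (k + 1) * norm (residual k))\<^sup>2" for k
  have c: "c > 0" using assms \<gamma> by (simp add: c_def)
  have a0: "0 \<le> a k" for k using c by (simp add: a_def)
  \<comment> \<open>The series is shifted because the step inequality is available only from index
    1.\<close>
  have "(\<Sum>k<t. a (Suc k)) \<le> potential ls 1" for t
  proof -
    have "(\<Sum>k<t. a (Suc k)) = (\<Sum>k = 1..t. a k)"
      by (simp add: lessThan_atLeast0 sum.shift_bounds_Suc_ivl[symmetric] atLeastLessThanSuc_atLeastAtMost)
    also have "\<dots> \<le> (\<Sum>k = 1..t. (real k + real_of_int k0 + 1)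
      * (gap (y (k + 1)) (z (k + 1)) - ls \<bullet> residual k
         + (1 - 1 / \<eta>) * (real (k + 1) * \<gamma>) / 2 * (norm (residual k))\<^sup>2))"
    proof (rule sum_mono)
      fix k assume "k \<in> {1..t}"
      then have k: "k \<ge> 1" by simp
      have "a k = real (k + 1) * ((1 - 1 / \<eta>) * (real (k + 1) * \<gamma>) / 2 * (norm (residual k))\<^sup>2)"
        by (simp add: a_def c_def power2_eq_square mult_ac)
      also have "\<dots> \<le> (real k + real_of_int k0 + 1)
          * (gap (y (k + 1)) (z (k + 1)) - ls \<bullet> residual k
         + (1 - 1 / \<eta>) * (real (k + 1) * \<gamma>) / 2 * (norm (residual k))\<^sup>2)"
        using k0_ge_1 lagrangian_gap_nonneg[OF k] slack_nonneg[of k] by (intro mult_mono) auto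
      finally show "a k \<le> \<dots>" .
    qed
    also have "\<dots> \<le> potential ls 1"
      using potential_sum[of ls t] potential_nonneg[of "t + 1" ls] by simp
    finally show ?thesis .
  qed
  then have "summable (\<lambda>k. a (Suc k))"
    by (intro summableI_nonneg_bounded a0)
  then have "(\<lambda>k. a (Suc k)) \<longlonglongrightarrow> 0" by (rule summable_LIMSEQ_zero)
  then have "a \<longlonglongrightarrow> 0" by (rule LIMSEQ_imp_Suc)
  then have "(\<lambda>k. sqrt (a k / c)) \<longlonglongrightarrow> sqrt (0 / c)"
    using c by (intro tendsto_intros) auto
  then show ?thesis using c by (simp add: a_def)
qed

text \<open>After multiplication by \<open>k + 1\<close> the Lagrangian gap lies between 0 and
  \<open>potential ls 1\<close>, and its linear part is bounded because the scaled residual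
  converges.\<close>

lemma gap_rate:
  assumes "\<eta> > 1"
  obtains D where "\<And>k. k \<ge> 1 \<Longrightarrow> \<bar>gap (y (k + 1)) (z (k + 1))\<bar> \<le> D / real (k + 1)"
proof -
  have "Bseq (\<lambda>k. real (k + 1) * norm (residual k))"
    using residual_rate[OF assms] by (intro convergent_imp_Bseq convergentI)
  then obtain M where M: "\<And>k. norm (real (k + 1) * norm (residual k)) \<le> M"
    by (auto simp: Bseq_def)
  have "\<bar>gap (y (k + 1)) (z (k + 1))\<bar> \<le> (potential ls 1 + norm ls * M) / real (k + 1)" if k: "k \<ge> 1" for k
  proof -
    let ?\<kappa> = "real (k + 1)" and ?G = "gap (y (k + 1)) (z (k + 1))"
    have "?\<kappa> * (norm ls * norm (residual k)) = norm ls * (?\<kappa> * norm (residual k))" by simp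
    also have "\<dots> \<le> norm ls * M" using M[of k] by (intro mult_left_mono) auto
    finally have r: "?\<kappa> * (norm ls * norm (residual k)) \<le> norm ls * M" .
    have "?\<kappa> * \<bar>ls \<bullet> residual k\<bar> \<le> ?\<kappa> * (norm ls * norm (residual k))"
      by (intro mult_left_mono Cauchy_Schwarz_ineq2) auto
    also note r
    finally have lr: "\<bar>?\<kappa> * (ls \<bullet> residual k)\<bar> \<le> norm ls * M" by (simp add: abs_mult)
    have nn: "0 \<le> ?G - ls \<bullet> residual k" by (rule lagrangian_gap_nonneg[OF k])
    then have lower: "0 \<le> ?\<kappa> * (?G - ls \<bullet> residual k)" by simp
    have "?\<kappa> * (?G - ls \<bullet> residual k) \<le> (?\<kappa> + real_of_int k0) * (?G - ls \<bullet> residual k)"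
      using k0_ge_1 nn by (intro mult_right_mono) auto
    also have "\<dots> \<le> potential ls 1"
      using gap_upper[OF k] potential_nonneg[of "k + 1" ls] by simp
    finally have "\<bar>?\<kappa> * ?G\<bar> \<le> potential ls 1 + norm ls * M"
      using lower lr unfolding right_diff_distrib by linarith
    then have "\<bar>?G\<bar> * ?\<kappa> \<le> potential ls 1 + norm ls * M" by (simp add: abs_mult mult.commute)
    then show ?thesis by (subst pos_le_divide_eq) auto
  qed
  with that show ?thesis .
qed

end

text \<open>Conventions for division by zero and infinite values shape the conclusion: for
  \<open>ls = 0\<close> the quotient by \<open>norm ls\<close> would be 0, so that case is excluded
  from the feasibility rate; and \<open>real_of_ereal\<close> would hide an infinite difference, so
  finiteness is asserted before the last rate.\<close>

theorem theorem2p9: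
  fixes f :: "real ^ 'm \<Rightarrow> ereal"
    and g :: "real ^ 'n \<Rightarrow> ereal"
    and h :: "real ^ 'n \<Rightarrow> real"
    and gh :: "real ^ 'n \<Rightarrow> real ^ 'n"
    and B :: "real ^ 'm ^ 'p"
    and C :: "real ^ 'n ^ 'p"
    and b :: "real ^ 'p"
    and P :: "real ^ 'm ^ 'm"
    and Q :: "real ^ 'n ^ 'n"
    and Lh \<mu>g \<mu>h \<gamma> \<eta> :: real
    and k0 :: int
    and y :: "nat \<Rightarrow> real ^ 'm"
    and z :: "nat \<Rightarrow> real ^ 'n"
    and l :: "nat \<Rightarrow> real ^ 'p"
    and ys :: "real ^ 'm"
    and zs :: "real ^ 'n"
    and ls :: "real ^ 'p"
  assumes f: "proper_closed_convex f"
    and g: "proper_closed_convex g"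
    and h_convex: "convex_on UNIV h"
    and h_grad: "\<forall>w. GDERIV h w :> gh w"
    and h_lipschitz: "Lh-lipschitz_on UNIV gh"
    and g_strong: "\<mu>g \<ge> 0" "strongly_convex \<mu>g g"
    and h_strong: "\<mu>h \<ge> 0" "strongly_convex \<mu>h (\<lambda>w. ereal (h w))"
    and \<mu>_pos: "\<mu>g + \<mu>h > 0"
    and \<gamma>: "\<gamma> > 0"
    and \<eta>: "\<eta> \<ge> 1"
    and P: "psd P"
    and Q_sym: "transpose Q = Q"
    and Q_lower: "loewner_le ((\<eta> * \<gamma>) *\<^sub>R (transpose C ** C)) Q"
    and Q_upper: "loewner_le Q (((\<mu>g + \<mu>h) / 2) *\<^sub>R mat 1)"
    and algorithm: "linearized_ADMM f g gh B C b
          (\<lambda>k. real (k + 1) * \<gamma>)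
          (\<lambda>k. real (k + 1) * \<gamma>)
          (\<lambda>k. (1 / real (k + 1)) *\<^sub>R P)
          (\<lambda>k. real (k + 1) *\<^sub>R (Q - \<gamma> *\<^sub>R (transpose C ** C)) + Lh *\<^sub>R mat 1)
          y z l"
    and k0: "k0 = k0_of Lh \<mu>g \<mu>h"
    and KKT: "KKT_point f g gh B C b ys zs ls"
  shows "(\<forall>k\<ge>1. wnorm2 Q (z k - zs)
            \<le> 2 * merit P Q \<gamma> Lh \<mu>g k0 1 (y 1) (z 1) (l 1) ys zs ls
                / (real k * (real k + real_of_int k0)))
       \<and> (\<forall>k\<ge>2. (norm (z k - zs))\<^sup>2
            \<le> 2 * merit P Q \<gamma> Lh \<mu>g k0 1 (y 1) (z 1) (l 1) ys zs ls
                / ((real k + real_of_int k0) * (Lh + \<mu>h + 2 * \<mu>g)))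
       \<and> (\<forall>t\<ge>1.
            \<bar>objective f g h (ergodic k0 y t) (ergodic k0 z t) - objective f g h ys zs\<bar>
            \<le> ereal (2 / (real t * (real t + 2 * real_of_int k0 + 3))
                * merit P Q \<gamma> Lh \<mu>g k0 1 (y 1) (z 1) (l 1) ys zs (2 *\<^sub>R ls)))
       \<and> (ls \<noteq> 0 \<longrightarrow> (\<forall>t\<ge>1.
            norm (B *v ergodic k0 y t + C *v ergodic k0 z t - b)
            \<le> 2 / (real t * (real t + 2 * real_of_int k0 + 3) * norm ls)
                * merit P Q \<gamma> Lh \<mu>g k0 1 (y 1) (z 1) (l 1) ys zs (2 *\<^sub>R ls)))
       \<and> (pd P \<and> \<eta> > 1 \<longrightarrow>
            bounded ((\<lambda>k. (y k, z k, l k)) ` {1..})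
          \<and> (\<lambda>k. norm (B *v y (k + 1) + C *v z (k + 1) - b)) \<in> o(\<lambda>k. 1 / real (k + 1))
          \<and> (\<forall>k\<ge>1. \<bar>objective f g h (y (k + 1)) (z (k + 1)) - objective f g h ys zs\<bar> \<noteq> \<infinity>)
          \<and> (\<lambda>k. real_of_ereal
                \<bar>objective f g h (y (k + 1)) (z (k + 1)) - objective f g h ys zs\<bar>)
              \<in> O(\<lambda>k. 1 / real (k + 1)))"
proof -
  interpret accelerated_ADMM f g h gh B C b P Q Lh \<mu>g \<mu>h \<gamma> \<eta> k0 y z l ys zs ls
    by (unfold_locales; fact)
  show ?thesis
    unfolding potential_def[symmetric] residual_def[symmetric]
  proof (intro conjI allI impI)
    fix k :: nat assume "1 \<le> k"
    then show "wnorm2 Q (z k - zs) \<le> 2 * potential ls 1 / (real k * (real k + real_of_int k0))"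
      by (rule z_rate_Q)
  next
    fix k :: nat assume "2 \<le> k"
    then show "(norm (z k - zs))\<^sup>2 \<le> 2 * potential ls 1 / ((real k + real_of_int k0) * (Lh + \<mu>h + 2 * \<mu>g))"
      by (rule z_rate)
  next
    fix t :: nat assume t: "1 \<le> t"
    show "\<bar>objective f g h (ergodic k0 y t) (ergodic k0 z t) - objective f g h ys zs\<bar>
        \<le> ereal (2 / (real t * (real t + 2 * real_of_int k0 + 3)) * potential (2 *\<^sub>R ls) 1)"
      unfolding objective_gap[OF ergodic_gap(1,2)[OF t]] using ergodic_rates(1)[OF t] by simp
  next
    fix t :: nat assume ls: "ls \<noteq> 0" and t: "1 \<le> t"
    define T where "T = real t * (real t + 2 * real_of_int k0 + 3)"
    have "norm (B *v ergodic k0 y t + C *v ergodic k0 z t - b) \<le> 2 / T * potential (2 *\<^sub>R ls) 1 / norm ls"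
      using ergodic_rates(2)[OF t] ls by (subst pos_le_divide_eq) (auto simp: T_def mult.commute)
    then show "norm (B *v ergodic k0 y t + C *v ergodic k0 z t - b)
        \<le> 2 / (real t * (real t + 2 * real_of_int k0 + 3) * norm ls) * potential (2 *\<^sub>R ls) 1"
      unfolding T_def[symmetric] by simp
  next
    assume "pd P \<and> \<eta> > 1"
    then show "bounded ((\<lambda>k. (y k, z k, l k)) ` {1..})" by (intro iterates_bounded) simp
  next
    assume "pd P \<and> \<eta> > 1"
    then have "(\<lambda>k. real (k + 1) * norm (residual k)) \<longlonglongrightarrow> 0" by (intro residual_rate) simp
    \<comment> \<open>The quotient by \<open>1 / real (k + 1)\<close> is the sequence just shown to
      vanish.\<close>
    then show "(\<lambda>k. norm (residual k)) \<in> o(\<lambda>k. 1 / real (k + 1))"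
      by (intro smalloI_tendsto) (simp_all add: mult.commute)
  next
    fix k :: nat assume "1 \<le> k"
    then show "\<bar>objective f g h (y (k + 1)) (z (k + 1)) - objective f g h ys zs\<bar> \<noteq> \<infinity>"
      using objective_gap[OF iterate_finite] by simp
  next
    assume "pd P \<and> \<eta> > 1"
    then obtain D where D: "\<And>k. k \<ge> 1 \<Longrightarrow> \<bar>gap (y (k + 1)) (z (k + 1))\<bar> \<le> D / real (k + 1)"
      using gap_rate by blast
    show "(\<lambda>k. real_of_ereal \<bar>objective f g h (y (k + 1)) (z (k + 1)) - objective f g h ys zs\<bar>)
        \<in> O(\<lambda>k. 1 / real (k + 1))"
    proof (rule bigoI)
      show "eventually (\<lambda>k. norm (real_of_ereal \<bar>objective f g h (y (k + 1)) (z (k + 1)) - objective f g h ys zs\<bar>)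
          \<le> D * norm (1 / real (k + 1))) sequentially"
        \<comment> \<open>Index 0 is skipped, since the bound on the gap starts with the first
          step.\<close>
        using eventually_ge_at_top[of 1]
      proof eventually_elim
        case (elim k)
        then show ?case using D[OF elim] objective_gap[OF iterate_finite[OF elim]] by simp
      qed
    qed
  qed
qed

end
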